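(* Every light homomorphism of Artin monoids is a composition of one or more homomorphisms of the following kinds: a tautological homomorphism; a parabolic projection; a natural inclusion (of a parabolic submonoid); a Tits homomorphism; a diagram automorphism; a folding along a surjective map of index sets of Coxeter matrices. In particular, every light homomorphism of Artin monoids is a morphism in $\mathscr{Ast}$, i.e. a composition of standard homomorphisms.
   Context: A Coxeter matrix over a finite set $I$ is a symmetric matrix $M=(m_{ij})_{i,j\in I}$ with $m_{ii}=1$ and $m_{ij}\in\mathbb Z_{\ge2}\cup\{\infty\}$ for $i\ne j$. $\mathrm{Br}^+(M)$ is the Artin monoid: generators $T_i$, $i\in I$, relations $T_iT_jT_i\cdots=T_jT_iT_j\cdots$ ($m_{ij}$ factors each) for $i\ne j$, $m_{ij}<\infty$. The symbol $\infty$ counts as divisible by every positive integer (in particular as even), and $n\cdot\infty=\infty$ for $n>0$. For $J\subset I$, $M_J=(m_{ij})_{i,j\in J}$ and $\mathrm{Br}^+_J(M)=\langle T_j:j\in J\rangle\cong\mathrm{Br}^+(M_J)$. A homomorphism $\Phi:\mathrm{Br}^+(\widehat M)\to\mathrm{Br}^+(M)$ (with $\widehat M$ over $\widehat I$, generators $\widehat T_i$) is light if for each $i\in\widehat I$ there are $j\in I$ and $d\in\mathbb Z_{\ge0}$ with $\Phi(\widehat T_i)=T_j^{d}$. Kinds of light homomorphisms: (1) tautological: $\mathrm{Br}^+(\widehat M)\to\mathrm{Br}^+(M)$, $\widehat T_i\mapsto T_i$, where $\widehat M=(d_{ij}m_{ij})_{i,j\in I}$ with $d_{ij}=d_{ji}\in\mathbb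 Z_{>0}\cup\{\infty\}$, $d_{ii}=1$; (2) parabolic projection $P_J:\mathrm{Br}^+(M)\to\mathrm{Br}^+_J(M)$, $T_i\mapsto T_i$ for $i\in J$, $T_i\mapsto1$ for $i\in I\setminus J$, defined when $m_{ij}$ is even for all $j\in J$, $i\in I\setminus J$; (3) natural inclusion $\mathrm{Br}^+(M_J)\cong\mathrm{Br}^+_J(M)\hookrightarrow\mathrm{Br}^+(M)$, $J\subset I$; (4) Tits homomorphism $\mathbf T_{\mathbf d}:\mathrm{Br}^+(M(\mathbf d))\to\mathrm{Br}^+(M)$, $\widehat T_i\mapsto T_i^{d_i}$, $\mathbf d\in\mathbb Z_{>0}^I$, where $m_{ij}(\mathbf d)=m_{ij}$ if $m_{ij}\le 2$ or $d_id_j=1$, $m_{ij}(\mathbf d)=2d_id_j$ if $m_{ij}=3$ and $d_id_j\in\{2,3\}$, and $m_{ij}(\mathbf d)=\infty$ otherwise; (5) diagram automorphism $T_i\mapsto T_{\sigma(i)}$ where $\sigma$ is a permutation of $I$ with $m_{\sigma(i)\sigma(j)}=m_{ij}$; (6) folding: let $\varpi:I\to J$ be surjective and suppose $m_{ii'}=m_{ii''}$ for all $i,i',i''\in I$ with $\varpi(i')=\varpi(i'')\ne\varpi(i)$; let $M^\varpi$ be the Coxeter matrix over $J$ with $(M^\varpi)_{jj'}=m_{ii'}$ for any $i\in\varpi^{-1}(j)$, $i'\in\varpi^{-1}(j')$, $j\neq j'$; the folding is $\mathbf F_\varpi:\mathrm{Br}^+(M)\to\mathrm{Br}^+(M^\varpi)$,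 $T_i\mapsto T^\varpi_{\varpi(i)}$, where $T^\varpi_j$, $j\in J$ are the generators of $\mathrm{Br}^+(M^\varpi)$. A homomorphism is standard if each generator of the domain is mapped to $T_{w_\circ^J}$ for some $J$ such that the parabolic subgroup $W_J$ of the Coxeter group of the codomain is finite; here $w_\circ^J$ is the longest element of $W_J$ and $T_w=T_{i_1}\cdots T_{i_k}$ for a reduced expression $w=s_{i_1}\cdots s_{i_k}$. $\mathscr{Ast}$ is the category of Coxeter matrices with morphisms the compositions of standard homomorphisms of the corresponding Artin monoids. *)

theory Defs
  imports "HOL-Algebra.Generated_Groups" "HOL-Library.Extended_Nat" "HOL-Library.Infinite_Typeclass"
begin

section \<open>Monoids presented by generators and relations\<close>

text \<open>\<open>word_cong I R\<close> is the least congruence on the free monoid \<open>lists I\<close> containing the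
  pairs of \<open>R\<close> that are words over \<open>I\<close>.\<close>

inductive_set word_cong :: "'a set \<Rightarrow> ('a list \<times> 'a list) set \<Rightarrow> ('a list \<times> 'a list) set"
  for I :: "'a set" and R :: "('a list \<times> 'a list) set" where
  rel: "\<lbrakk>(u, v) \<in> R; u \<in> lists I; v \<in> lists I; p \<in> lists I; q \<in> lists I\<rbrakk>
        \<Longrightarrow> (p @ u @ q, p @ v @ q) \<in> word_cong I R"
| refl: "w \<in> lists I \<Longrightarrow> (w, w) \<in> word_cong I R"
| sym: "(u, v) \<in> word_cong I R \<Longrightarrow> (v, u) \<in> word_cong I R"
| trans: "\<lbrakk>(u, v) \<in> word_cong I R; (v, w) \<in> word_cong I R\<rbrakk> \<Longrightarrow> (u, w) \<in> word_cong I R"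

definition word_class :: "'a set \<Rightarrow> ('a list \<times> 'a list) set \<Rightarrow> 'a list \<Rightarrow> 'a list set" where
  "word_class I R w = word_cong I R `` {w}"

definition presented_monoid :: "'a set \<Rightarrow> ('a list \<times> 'a list) set \<Rightarrow> 'a list set monoid" where
  "presented_monoid I R =
     \<lparr>carrier = lists I // word_cong I R,
      mult = (\<lambda>X Y. \<Union>x\<in>X. \<Union>y\<in>Y. word_class I R (x @ y)),
      one = word_class I R []\<rparr>"

lemma word_cong_lists:
  "(u, v) \<in> word_cong I R \<Longrightarrow> u \<in> lists I \<and> v \<in> lists I"
  by (induction rule: word_cong.induct) auto

lemma equiv_word_cong: "equiv (lists I) (word_cong I R)"
  by (rule equivI)
    (auto intro!: refl_onI symI transI dest: word_cong_lists intro: word_cong.intros)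

lemma word_cong_context:
  assumes "(u, v) \<in> word_cong I R" "p \<in> lists I" "q \<in> lists I"
  shows "(p @ u @ q, p @ v @ q) \<in> word_cong I R"
  using assms
proof (induction rule: word_cong.induct)
  case (rel u v p' q')
  then show ?case using word_cong.rel[of u v R I "p @ p'" "q' @ q"] by simp
next
  case (refl w)
  then show ?case by (intro word_cong.refl) simp
qed (blast intro: word_cong.intros)+

lemma word_cong_append:
  assumes "(u, u') \<in> word_cong I R" "(v, v') \<in> word_cong I R"
  shows "(u @ v, u' @ v') \<in> word_cong I R"
proof -
  have "(u @ v, u' @ v) \<in> word_cong I R"
    using word_cong_context[of u u' I R "[]" v] assms word_cong_lists by fastforce
  moreover have "(u' @ v, u' @ v') \<in> word_cong I R"
    using word_cong_context[of v v' I R u' "[]"] assms word_cong_lists by fastforce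
  ultimately show ?thesis by (rule word_cong.trans)
qed

lemma word_class_mult:
  assumes "u \<in> lists I" "v \<in> lists I"
  shows "word_class I R u \<otimes>\<^bsub>presented_monoid I R\<^esub> word_class I R v = word_class I R (u @ v)"
proof -
  have "congruent2 (word_cong I R) (word_cong I R) (\<lambda>x y. word_class I R (x @ y))"
    unfolding congruent2_def word_class_def
    by (auto simp del: append_in_lists_conv
        intro!: equiv_class_eq[OF equiv_word_cong] word_cong_append)
  from UN_equiv_class2[OF equiv_word_cong equiv_word_cong this assms]
  show ?thesis by (simp add: presented_monoid_def word_class_def)
qed

lemma word_class_carrier:
  "w \<in> lists I \<Longrightarrow> word_class I R w \<in> carrier (presented_monoid I R)"
  by (simp add: presented_monoid_def word_class_def quotientI)

lemma carrier_presentedE: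
  assumes "x \<in> carrier (presented_monoid I R)"
  obtains w where "w \<in> lists I" "x = word_class I R w"
  using assms by (auto simp: presented_monoid_def word_class_def elim!: quotientE)

lemma one_presented: "\<one>\<^bsub>presented_monoid I R\<^esub> = word_class I R []"
  by (simp add: presented_monoid_def)

lemma monoid_presented: "monoid (presented_monoid I R)"
proof (rule monoidI)
  fix x y z
  assume x: "x \<in> carrier (presented_monoid I R)"
  from x obtain u where u: "u \<in> lists I" "x = word_class I R u"
    by (rule carrier_presentedE)
  show "\<one>\<^bsub>presented_monoid I R\<^esub> \<otimes>\<^bsub>presented_monoid I R\<^esub> x = x"
    and "x \<otimes>\<^bsub>presented_monoid I R\<^esub> \<one>\<^bsub>presented_monoid I R\<^esub> = x"
    using word_class_mult[of "[]" I u R] word_class_mult[of u I "[]" R] u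
    by (simp_all add: one_presented)
  assume y: "y \<in> carrier (presented_monoid I R)"
  from y obtain v where v: "v \<in> lists I" "y = word_class I R v"
    by (rule carrier_presentedE)
  have uv: "u @ v \<in> lists I" using u v by simp
  show "x \<otimes>\<^bsub>presented_monoid I R\<^esub> y \<in> carrier (presented_monoid I R)"
    unfolding u v word_class_mult[OF u(1) v(1)] by (rule word_class_carrier[OF uv])
  assume z: "z \<in> carrier (presented_monoid I R)"
  from z obtain w where w: "w \<in> lists I" "z = word_class I R w"
    by (rule carrier_presentedE)
  have vw: "v @ w \<in> lists I" using v w by simp
  show "x \<otimes>\<^bsub>presented_monoid I R\<^esub> y \<otimes>\<^bsub>presented_monoid I R\<^esub> z =
        x \<otimes>\<^bsub>presented_monoid I R\<^esub> (y \<otimes>\<^bsub>presented_monoid I R\<^esub> z)"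
    unfolding u v w word_class_mult[OF u(1) v(1)] word_class_mult[OF v(1) w(1)]
      word_class_mult[OF uv w(1)] word_class_mult[OF u(1) vw] by simp
next
  show "\<one>\<^bsub>presented_monoid I R\<^esub> \<in> carrier (presented_monoid I R)"
    by (simp add: one_presented word_class_carrier)
qed

section \<open>Coxeter matrices, Artin monoids and Coxeter groups\<close>

text \<open>Only the values of \<open>entry M\<close> on \<open>index M\<close> are meaningful; the conditions below never
  constrain the other ones.\<close>

record 'a coxeter_matrix =
  index :: "'a set"
  entry :: "'a \<Rightarrow> 'a \<Rightarrow> enat"

definition is_coxeter_matrix :: "'a coxeter_matrix \<Rightarrow> bool" where
  "is_coxeter_matrix M \<longleftrightarrow> finite (index M) \<and>
     (\<forall>i\<in>index M. entry M i i = 1) \<and>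
     (\<forall>i\<in>index M. \<forall>j\<in>index M. i \<noteq> j \<longrightarrow> entry M i j \<ge> 2) \<and>
     (\<forall>i\<in>index M. \<forall>j\<in>index M. entry M i j = entry M j i)"

text \<open>The alternating word \<open>i j i \<dots>\<close> with \<open>n\<close> letters.\<close>

fun alt_word :: "nat \<Rightarrow> 'a \<Rightarrow> 'a \<Rightarrow> 'a list" where
  "alt_word 0 i j = []"
| "alt_word (Suc n) i j = i # alt_word n j i"

definition braid_relations :: "'a coxeter_matrix \<Rightarrow> ('a list \<times> 'a list) set" where
  "braid_relations M =
     {(alt_word n i j, alt_word n j i) | i j n.
        i \<in> index M \<and> j \<in> index M \<and> i \<noteq> j \<and> entry M i j = enat n}"

definition artin_monoid :: "'a coxeter_matrix \<Rightarrow> 'a list set monoid" where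
  "artin_monoid M = presented_monoid (index M) (braid_relations M)"

definition artin_word :: "'a coxeter_matrix \<Rightarrow> 'a list \<Rightarrow> 'a list set" where
  "artin_word M w = word_class (index M) (braid_relations M) w"

definition artin_gen :: "'a coxeter_matrix \<Rightarrow> 'a \<Rightarrow> 'a list set" where
  "artin_gen M i = artin_word M [i]"

text \<open>The relations \<open>(s\<^sub>i s\<^sub>j)^m\<^sub>i\<^sub>j = 1\<close>. The case \<open>i = j\<close> is \<open>s\<^sub>i\<^sup>2 = 1\<close>, so that the monoid
  with this presentation is a group, namely the Coxeter group.\<close>

definition coxeter_relations :: "'a coxeter_matrix \<Rightarrow> ('a list \<times> 'a list) set" where
  "coxeter_relations M =
     {(concat (replicate n [i, j]), []) | i j n.
        i \<in> index M \<and> j \<in> index M \<and> entry M i j = enat n}"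

definition coxeter_group :: "'a coxeter_matrix \<Rightarrow> 'a list set monoid" where
  "coxeter_group M = presented_monoid (index M) (coxeter_relations M)"

definition coxeter_gen :: "'a coxeter_matrix \<Rightarrow> 'a \<Rightarrow> 'a list set" where
  "coxeter_gen M i = word_class (index M) (coxeter_relations M) [i]"

lemma group_coxeter_group:
  assumes "is_coxeter_matrix M"
  shows "group (coxeter_group M)"
proof -
  let ?I = "index M" and ?R = "coxeter_relations M"
  have square: "([i, i], []) \<in> ?R" if "i \<in> ?I" for i
    using that assms unfolding coxeter_relations_def is_coxeter_matrix_def
    by (auto intro!: exI[of _ i] exI[of _ "1::nat"] simp: one_enat_def)
  have inverse: "(rev w @ w, []) \<in> word_cong ?I ?R" if "w \<in> lists ?I" for w
    using that
  proof (induction w rule: list.induct)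
    case Nil
    then show ?case by (simp add: word_cong.refl)
  next
    case (Cons i w)
    then have w: "w \<in> lists ?I" and i: "i \<in> ?I" by auto
    have "(rev w @ [i, i] @ w, rev w @ [] @ w) \<in> word_cong ?I ?R"
      using w i square[OF i] by (intro word_cong.rel) auto
    then show ?case using Cons.IH[OF w] word_cong.trans by fastforce
  qed
  have "\<exists>y\<in>carrier (coxeter_group M). y \<otimes>\<^bsub>coxeter_group M\<^esub> x = \<one>\<^bsub>coxeter_group M\<^esub>"
    if x: "x \<in> carrier (coxeter_group M)" for x
  proof -
    obtain w where w: "w \<in> lists ?I" "x = word_class ?I ?R w"
      using x unfolding coxeter_group_def by (rule carrier_presentedE)
    have rw: "rev w \<in> lists ?I" using w by auto
    have "word_class ?I ?R (rev w @ w) = word_class ?I ?R []"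
      unfolding word_class_def
      by (rule equiv_class_eq[OF equiv_word_cong inverse]) (rule w(1))
    then have "word_class ?I ?R (rev w) \<otimes>\<^bsub>coxeter_group M\<^esub> x = \<one>\<^bsub>coxeter_group M\<^esub>"
      unfolding w(2) coxeter_group_def one_presented word_class_mult[OF rw w(1)] .
    then show ?thesis
      using word_class_carrier[OF rw] unfolding coxeter_group_def by blast
  qed
  moreover have "monoid (coxeter_group M)"
    unfolding coxeter_group_def by (rule monoid_presented)
  ultimately show ?thesis
    by (intro groupI) (auto simp: monoid.m_closed monoid.one_closed monoid.m_assoc monoid.l_one)
qed

definition parabolic_subgroup :: "'a coxeter_matrix \<Rightarrow> 'a set \<Rightarrow> 'a list set set" where
  "parabolic_subgroup M J = generate (coxeter_group M) (coxeter_gen M ` J)"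

text \<open>An element of the Coxeter group is the set of all words over \<open>index M\<close> representing it.\<close>

definition coxeter_length :: "'a list set \<Rightarrow> nat" where
  "coxeter_length w = (LEAST n. \<exists>ws\<in>w. length ws = n)"

definition reduced_expression :: "'a list \<Rightarrow> 'a list set \<Rightarrow> bool" where
  "reduced_expression ws w \<longleftrightarrow> ws \<in> w \<and> length ws = coxeter_length w"

definition is_longest_element :: "'a coxeter_matrix \<Rightarrow> 'a set \<Rightarrow> 'a list set \<Rightarrow> bool" where
  "is_longest_element M J w \<longleftrightarrow> w \<in> parabolic_subgroup M J \<and>
     (\<forall>v\<in>parabolic_subgroup M J. coxeter_length v \<le> coxeter_length w)"

section \<open>Homomorphisms of Artin monoids\<close>

definition artin_hom ::
  "'a coxeter_matrix \<Rightarrow> 'a coxeter_matrix \<Rightarrow> ('a list set \<Rightarrow> 'a list set) \<Rightarrow> bool" where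
  "artin_hom A B \<phi> \<longleftrightarrow> is_coxeter_matrix A \<and> is_coxeter_matrix B \<and>
     \<phi> \<in> hom (artin_monoid A) (artin_monoid B) \<and>
     \<phi> \<one>\<^bsub>artin_monoid A\<^esub> = \<one>\<^bsub>artin_monoid B\<^esub>"

definition light where
  "light A B \<phi> \<longleftrightarrow> artin_hom A B \<phi> \<and>
     (\<forall>i\<in>index A. \<exists>j\<in>index B. \<exists>d::nat.
        \<phi> (artin_gen A i) = artin_gen B j [^]\<^bsub>artin_monoid B\<^esub> d)"

definition tautological where
  "tautological A B \<phi> \<longleftrightarrow> artin_hom A B \<phi> \<and> index A = index B \<and>
     (\<exists>d :: 'a \<Rightarrow> 'a \<Rightarrow> enat.
        (\<forall>i\<in>index B. d i i = 1) \<and>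
        (\<forall>i\<in>index B. \<forall>j\<in>index B. d i j = d j i \<and> d i j > 0 \<and>
            entry A i j = d i j * entry B i j)) \<and>
     (\<forall>i\<in>index A. \<phi> (artin_gen A i) = artin_gen B i)"
  for A B :: "'a coxeter_matrix"

text \<open>\<open>B = A\<^sub>J\<close> for \<open>J = index B\<close>.\<close>

definition is_submatrix :: "'a coxeter_matrix \<Rightarrow> 'a coxeter_matrix \<Rightarrow> bool" where
  "is_submatrix B A \<longleftrightarrow> index B \<subseteq> index A \<and>
     (\<forall>i\<in>index B. \<forall>j\<in>index B. entry B i j = entry A i j)"

text \<open>The submonoid generated by the \<open>T\<^sub>j\<close>, \<open>j \<in> J\<close>, is identified with the Artin monoid of the
  submatrix over \<open>J\<close>, both as the target of a parabolic projection and as the source of a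
  natural inclusion. Divisibility by 2 in \<^typ>\<open>enat\<close> holds for \<open>\<infinity>\<close>.\<close>

definition parabolic_projection where
  "parabolic_projection A B \<phi> \<longleftrightarrow> artin_hom A B \<phi> \<and> is_submatrix B A \<and>
     (\<forall>j\<in>index B. \<forall>i\<in>index A - index B. 2 dvd entry A i j) \<and>
     (\<forall>i\<in>index B. \<phi> (artin_gen A i) = artin_gen B i) \<and>
     (\<forall>i\<in>index A - index B. \<phi> (artin_gen A i) = \<one>\<^bsub>artin_monoid B\<^esub>)"

definition natural_inclusion where
  "natural_inclusion A B \<phi> \<longleftrightarrow> artin_hom A B \<phi> \<and> is_submatrix A B \<and>
     (\<forall>i\<in>index A. \<phi> (artin_gen A i) = artin_gen B i)"

definition tits_entry :: "enat \<Rightarrow> nat \<Rightarrow> nat \<Rightarrow> enat" where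
  "tits_entry m a b =
     (if m \<le> 2 \<or> a * b = 1 then m
      else if m = 3 \<and> a * b \<in> {2, 3} then enat (2 * a * b)
      else \<infinity>)"

definition tits_hom where
  "tits_hom A B \<phi> \<longleftrightarrow> artin_hom A B \<phi> \<and> index A = index B \<and>
     (\<exists>d :: 'a \<Rightarrow> nat.
        (\<forall>i\<in>index B. d i > 0) \<and>
        (\<forall>i\<in>index B. \<forall>j\<in>index B. entry A i j = tits_entry (entry B i j) (d i) (d j)) \<and>
        (\<forall>i\<in>index A. \<phi> (artin_gen A i) = artin_gen B i [^]\<^bsub>artin_monoid B\<^esub> d i))"
  for A B :: "'a coxeter_matrix"

text \<open>A diagram automorphism is an endomorphism; the matrices \<open>A\<close> and \<open>B\<close> are equal up to the
  meaningless entries.\<close>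

definition diagram_automorphism where
  "diagram_automorphism A B \<phi> \<longleftrightarrow> artin_hom A B \<phi> \<and> index A = index B \<and>
     (\<forall>i\<in>index B. \<forall>j\<in>index B. entry A i j = entry B i j) \<and>
     (\<exists>\<sigma>. bij_betw \<sigma> (index B) (index B) \<and>
        (\<forall>i\<in>index B. \<forall>j\<in>index B. entry B (\<sigma> i) (\<sigma> j) = entry B i j) \<and>
        (\<forall>i\<in>index A. \<phi> (artin_gen A i) = artin_gen B (\<sigma> i)))"

definition folding where
  "folding A B \<phi> \<longleftrightarrow> artin_hom A B \<phi> \<and>
     (\<exists>f :: 'a \<Rightarrow> 'a. f ` index A = index B \<and>
        (\<forall>i\<in>index A. \<forall>i'\<in>index A. \<forall>i''\<in>index A.
            f i' = f i'' \<and> f i'' \<noteq> f i \<longrightarrow> entry A i i' = entry A i i'') \<and>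
        (\<forall>i\<in>index A. \<forall>i'\<in>index A. f i \<noteq> f i' \<longrightarrow> entry B (f i) (f i') = entry A i i') \<and>
        (\<forall>i\<in>index A. \<phi> (artin_gen A i) = artin_gen B (f i)))"
  for A B :: "'a coxeter_matrix"

definition elementary_light where
  "elementary_light A B \<phi> \<longleftrightarrow>
     tautological A B \<phi> \<or> parabolic_projection A B \<phi> \<or> natural_inclusion A B \<phi> \<or>
     tits_hom A B \<phi> \<or> diagram_automorphism A B \<phi> \<or> folding A B \<phi>"

text \<open>Each generator goes to \<open>T\<^sub>w\<close>, where \<open>w\<close> is the longest element of a finite parabolic
  subgroup. By Matsumoto's theorem \<open>T\<^sub>w\<close> does not depend on the reduced expression \<open>ws\<close> of
  \<open>w\<close>, and a finite parabolic subgroup has only one element of maximal length.\<close>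

definition standard where
  "standard A B \<phi> \<longleftrightarrow> artin_hom A B \<phi> \<and>
     (\<forall>i\<in>index A. \<exists>J\<subseteq>index B. finite (parabolic_subgroup B J) \<and>
        (\<exists>w ws. is_longest_element B J w \<and> reduced_expression ws w \<and>
           \<phi> (artin_gen A i) = artin_word B ws))"

text \<open>Compositions of one or more homomorphisms of kind \<open>K\<close>. A homomorphism is determined by its
  values on the carrier of its source, hence the equality in each rule is on carriers only.\<close>

inductive composition_of ::
  "('a coxeter_matrix \<Rightarrow> 'a coxeter_matrix \<Rightarrow> ('a list set \<Rightarrow> 'a list set) \<Rightarrow> bool) \<Rightarrow>
   'a coxeter_matrix \<Rightarrow> 'a coxeter_matrix \<Rightarrow> ('a list set \<Rightarrow> 'a list set) \<Rightarrow> bool"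
  for K where
  single: "\<lbrakk>K A B \<phi>; \<forall>x\<in>carrier (artin_monoid A). \<chi> x = \<phi> x\<rbrakk> \<Longrightarrow> composition_of K A B \<chi>"
| compose: "\<lbrakk>composition_of K A B \<phi>; K B C \<psi>;
             \<forall>x\<in>carrier (artin_monoid A). \<chi> x = \<psi> (\<phi> x)\<rbrakk> \<Longrightarrow> composition_of K A C \<chi>"

text \<open>The morphisms of the category of Coxeter matrices and compositions of standard
  homomorphisms.\<close>

definition ast_morphism where
  "ast_morphism = composition_of standard"

end

theory Submission
  imports Defs Complex_Main "HOL-Library.Sublist" "HOL-Number_Theory.Cong"
begin

text \<open>
  Let \<open>\<Phi>(T\<^sub>i) = T\<^bsub>f i\<^esub>\<^bsup>d i\<^esup>\<close> be light. The indices with \<open>d i = 0\<close> are removed by a parabolic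
  projection; degree considerations give the parity it requires. For \<open>f i \<noteq> f j\<close> the key point is
  that two powers \<open>T\<^sub>a\<^sup>p\<close>, \<open>T\<^sub>b\<^sup>q\<close> can satisfy a braid relation of length \<open>n\<close> only if \<open>n\<close> is a multiple
  of the entry of the Tits matrix. For \<open>p = q = 1\<close> this is read off the dihedral group, for
  \<open>m\<^sub>a\<^sub>b = 3\<close> off the representation in \<open>SL\<^sub>2(\<int>)\<close>, and for \<open>m\<^sub>a\<^sub>b \<ge> 4\<close> and \<open>pq \<ge> 2\<close> no braid move
  applies to the words in question. Hence \<open>\<Phi>\<close> is a projection followed by a tautological
  homomorphism, the folding identifying \<open>i\<close> and \<open>j\<close> when \<open>(f i, d i) = (f j, d j)\<close>, a Tits
  homomorphism, the folding along \<open>f\<close> and an inclusion.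

  Of these only the Tits homomorphism is not itself standard. It is the folding of
  \<open>T\<^sub>i \<mapsto> T\<^bsub>(i,1)\<^esub> \<dots> T\<^bsub>(i,d i)\<^esub>\<close>, a product of commuting generators. Such a product is the longest
  element of a finite parabolic subgroup: the geometric representation shows that every word for it
  contains all its letters.
\<close>

section \<open>Homomorphisms given on words\<close>

abbreviation braid_cong :: "'a coxeter_matrix \<Rightarrow> ('a list \<times> 'a list) set" where
  "braid_cong M \<equiv> word_cong (index M) (braid_relations M)"

abbreviation word_subst :: "('a \<Rightarrow> 'b list) \<Rightarrow> 'a list \<Rightarrow> 'b list" where
  "word_subst g w \<equiv> concat (map g w)"

lemma word_subst_comp: "word_subst h (word_subst g w) = word_subst (\<lambda>i. word_subst h (g i)) w"
  by (induction w) auto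

lemma word_subst_in_lists:
  "\<lbrakk>w \<in> lists I; \<And>i. i \<in> I \<Longrightarrow> g i \<in> lists K\<rbrakk> \<Longrightarrow> word_subst g w \<in> lists K"
  by (induction w) auto

lemma word_subst_cong:
  "\<lbrakk>w \<in> lists I; \<And>i. i \<in> I \<Longrightarrow> g i = h i\<rbrakk> \<Longrightarrow> word_subst g w = word_subst h w"
  by (induction w) auto

lemma word_class_eq_iff:
  "\<lbrakk>u \<in> lists I; v \<in> lists I\<rbrakk> \<Longrightarrow> word_class I R u = word_class I R v \<longleftrightarrow> (u, v) \<in> word_cong I R"
  unfolding word_class_def by (rule eq_equiv_class_iff[OF equiv_word_cong])

text \<open>Passes from a single rewriting step to the whole congruence. The maps \<open>f\<close>
  used below are the length, the number of occurrences of a letter, and actions on integers, on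
  pairs of integers and on real functions.\<close>

lemma word_cong_induct_invariant:
  assumes "(u, v) \<in> word_cong I R"
    and "\<And>u v p q. \<lbrakk>(u, v) \<in> R; u \<in> lists I; v \<in> lists I; p \<in> lists I; q \<in> lists I\<rbrakk>
      \<Longrightarrow> f (p @ u @ q) = f (p @ v @ q)"
  shows "f u = f v"
  using assms(1) by (induction rule: word_cong.induct) (auto simp: assms(2))

lemma word_cong_map:
  assumes "(u, v) \<in> word_cong I R" "\<And>i. i \<in> I \<Longrightarrow> g i \<in> lists K"
    and "\<And>u v. \<lbrakk>(u, v) \<in> R; u \<in> lists I; v \<in> lists I\<rbrakk> \<Longrightarrow> (word_subst g u, word_subst g v) \<in> word_cong K S"
  shows "(word_subst g u, word_subst g v) \<in> word_cong K S"
  using assms(1)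
proof (induction rule: word_cong.induct)
  case (rel u v p q)
  have "word_subst g p \<in> lists K" "word_subst g q \<in> lists K"
    using word_subst_in_lists[OF rel(4)] word_subst_in_lists[OF rel(5)] assms(2) by blast+
  then show ?case
    using word_cong_context[OF assms(3)[OF rel(1-3)]] by simp
next
  case (refl w)
  then show ?case by (intro word_cong.refl word_subst_in_lists[of w I]) (auto simp: assms(2))
qed (blast intro: word_cong.intros)+

lemma set_alt_word: "set (alt_word n i j) \<subseteq> {i, j}"
  by (induction n arbitrary: i j) (simp, fastforce)

lemma alt_word_in_lists [simp]: "\<lbrakk>i \<in> I; j \<in> I\<rbrakk> \<Longrightarrow> alt_word n i j \<in> lists I"
  by (induction n arbitrary: i j) auto

lemma length_alt_word [simp]: "length (alt_word n i j) = n"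
  by (induction n arbitrary: i j) auto

lemma map_alt_word: "map f (alt_word n i j) = alt_word n (f i) (f j)"
  by (induction n arbitrary: i j) auto

lemma alt_word_add:
  "alt_word (m + n) i j = alt_word m i j @ (if even m then alt_word n i j else alt_word n j i)"
  by (induction m arbitrary: i j) auto

lemma braid_relationsI:
  "\<lbrakk>i \<in> index M; j \<in> index M; i \<noteq> j; entry M i j = enat n\<rbrakk>
    \<Longrightarrow> (alt_word n i j, alt_word n j i) \<in> braid_relations M"
  unfolding braid_relations_def by blast

lemma braid_relationsE:
  assumes "(u, v) \<in> braid_relations M"
  obtains i j n where "i \<in> index M" "j \<in> index M" "i \<noteq> j" "entry M i j = enat n"
    "u = alt_word n i j" "v = alt_word n j i"
  using assms unfolding braid_relations_def by blast

lemma braid_relation_cong: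
  assumes "i \<in> index M" "j \<in> index M" "i \<noteq> j" "entry M i j = enat n"
  shows "(alt_word n i j, alt_word n j i) \<in> braid_cong M"
  using word_cong.rel[OF braid_relationsI[OF assms], of "index M" "[]" "[]"] assms by simp

text \<open>The relation is applied to the first \<open>n\<close> letters and the induction
  hypothesis to the rest. After an odd number of letters the rest starts with the other letter, so
  for odd \<open>n\<close> the induction hypothesis is used in reverse.\<close>

lemma alt_word_cong_multiple:
  assumes "(alt_word n i j, alt_word n j i) \<in> word_cong I R" "i \<in> I" "j \<in> I"
  shows "(alt_word (c * n) i j, alt_word (c * n) j i) \<in> word_cong I R"
proof (induction c)
  case 0
  show ?case by (simp add: word_cong.refl)
next
  case (Suc c)
  show ?case
    using word_cong_append[OF assms(1) Suc] word_cong_append[OF assms(1) word_cong.sym[OF Suc]]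
    by (cases "even n") (simp_all add: alt_word_add)
qed

lemma artin_word_eq_iff:
  "\<lbrakk>u \<in> lists (index M); v \<in> lists (index M)\<rbrakk>
    \<Longrightarrow> artin_word M u = artin_word M v \<longleftrightarrow> (u, v) \<in> braid_cong M"
  unfolding artin_word_def by (rule word_class_eq_iff)

lemma artin_word_carrier: "w \<in> lists (index M) \<Longrightarrow> artin_word M w \<in> carrier (artin_monoid M)"
  unfolding artin_word_def artin_monoid_def by (rule word_class_carrier)

lemma artin_carrierE:
  assumes "x \<in> carrier (artin_monoid M)"
  obtains w where "w \<in> lists (index M)" "x = artin_word M w"
  using assms unfolding artin_word_def artin_monoid_def by (rule carrier_presentedE)

lemma artin_word_mult:
  "\<lbrakk>u \<in> lists (index M); v \<in> lists (index M)\<rbrakk>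
    \<Longrightarrow> artin_word M u \<otimes>\<^bsub>artin_monoid M\<^esub> artin_word M v = artin_word M (u @ v)"
  unfolding artin_word_def artin_monoid_def by (rule word_class_mult)

lemma one_artin: "\<one>\<^bsub>artin_monoid M\<^esub> = artin_word M []"
  unfolding artin_word_def artin_monoid_def by (rule one_presented)

lemma artin_gen_pow:
  assumes "j \<in> index M"
  shows "artin_gen M j [^]\<^bsub>artin_monoid M\<^esub> (d::nat) = artin_word M (replicate d j)"
proof (induction d)
  case 0
  show ?case by (simp add: one_artin)
next
  case (Suc d)
  have "artin_gen M j [^]\<^bsub>artin_monoid M\<^esub> Suc d = artin_word M (replicate d j @ [j])"
    using Suc assms artin_word_mult[of "replicate d j" M "[j]"]
    by (simp add: artin_gen_def in_lists_conv_set)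
  then show ?case by (simp add: replicate_append_same)
qed

text \<open>The working form of a homomorphism: one word for each generator. Substitutions can be
  composed and compared directly, whereas an \<open>artin_hom\<close> acts on classes of
  words.\<close>

definition braid_hom :: "'a coxeter_matrix \<Rightarrow> 'b coxeter_matrix \<Rightarrow> ('a \<Rightarrow> 'b list) \<Rightarrow> bool" where
  "braid_hom A B g \<longleftrightarrow> is_coxeter_matrix A \<and> is_coxeter_matrix B \<and>
     (\<forall>i\<in>index A. g i \<in> lists (index B)) \<and>
     (\<forall>(u, v)\<in>braid_relations A. (word_subst g u, word_subst g v) \<in> braid_cong B)"

text \<open>The representative is arbitrary; \<open>induced_hom_word\<close> shows that on the
  carrier its choice does not matter.\<close>

definition induced_hom :: "'b coxeter_matrix \<Rightarrow> ('a \<Rightarrow> 'b list) \<Rightarrow> 'a list set \<Rightarrow> 'b list set" where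
  "induced_hom B g X = artin_word B (word_subst g (SOME w. w \<in> X))"

lemma braid_hom_in_lists:
  "\<lbrakk>braid_hom A B g; w \<in> lists (index A)\<rbrakk> \<Longrightarrow> word_subst g w \<in> lists (index B)"
  by (rule word_subst_in_lists) (auto simp: braid_hom_def)

lemma braid_hom_cong:
  "\<lbrakk>braid_hom A B g; (u, v) \<in> braid_cong A\<rbrakk> \<Longrightarrow> (word_subst g u, word_subst g v) \<in> braid_cong B"
  by (rule word_cong_map) (auto simp: braid_hom_def)

lemma induced_hom_word:
  assumes "braid_hom A B g" "w \<in> lists (index A)"
  shows "induced_hom B g (artin_word A w) = artin_word B (word_subst g w)"
proof -
  have "w \<in> artin_word A w"
    using assms(2) by (simp add: artin_word_def word_class_def word_cong.refl)
  then have "(SOME v. v \<in> artin_word A w) \<in> artin_word A w" by (rule someI)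
  then have "(w, SOME v. v \<in> artin_word A w) \<in> braid_cong A"
    by (simp add: artin_word_def word_class_def)
  note cong = braid_hom_cong[OF assms(1) this]
  show ?thesis
    unfolding induced_hom_def
    using artin_word_eq_iff[of _ B] word_cong_lists[OF cong] word_cong.sym[OF cong] by blast
qed

lemma induced_hom_gen:
  "\<lbrakk>braid_hom A B g; i \<in> index A\<rbrakk> \<Longrightarrow> induced_hom B g (artin_gen A i) = artin_word B (g i)"
  by (simp add: artin_gen_def induced_hom_word)

lemma induced_hom_letter:
  "\<lbrakk>braid_hom A B (\<lambda>i. [f i]); i \<in> index A\<rbrakk>
    \<Longrightarrow> induced_hom B (\<lambda>i. [f i]) (artin_gen A i) = artin_gen B (f i)"
  by (simp add: induced_hom_gen artin_gen_def[of B])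

lemma artin_hom_induced:
  assumes "braid_hom A B g"
  shows "artin_hom A B (induced_hom B g)"
proof -
  have "induced_hom B g \<in> hom (artin_monoid A) (artin_monoid B)"
  proof (rule homI)
    fix x y assume x: "x \<in> carrier (artin_monoid A)" and y: "y \<in> carrier (artin_monoid A)"
    from x obtain u where u: "u \<in> lists (index A)" "x = artin_word A u" by (rule artin_carrierE)
    from y obtain v where v: "v \<in> lists (index A)" "y = artin_word A v" by (rule artin_carrierE)
    have gu: "word_subst g u \<in> lists (index B)" and gv: "word_subst g v \<in> lists (index B)"
      using braid_hom_in_lists[OF assms] u(1) v(1) by blast+
    have uv: "u @ v \<in> lists (index A)" using u v by simp
    show "induced_hom B g x \<in> carrier (artin_monoid B)"
      unfolding u(2) induced_hom_word[OF assms u(1)] using gu by (rule artin_word_carrier)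
    show "induced_hom B g (x \<otimes>\<^bsub>artin_monoid A\<^esub> y) =
        induced_hom B g x \<otimes>\<^bsub>artin_monoid B\<^esub> induced_hom B g y"
      unfolding u(2) v(2) artin_word_mult[OF u(1) v(1)] induced_hom_word[OF assms u(1)]
        induced_hom_word[OF assms v(1)] induced_hom_word[OF assms uv] artin_word_mult[OF gu gv]
      by simp
  qed
  then show ?thesis
    using assms induced_hom_word[OF assms, of "[]"] by (simp add: artin_hom_def one_artin braid_hom_def)
qed

lemma artin_hom_word:
  assumes "artin_hom A B \<phi>" "\<And>i. i \<in> index A \<Longrightarrow> g i \<in> lists (index B)"
    and "\<And>i. i \<in> index A \<Longrightarrow> \<phi> (artin_gen A i) = artin_word B (g i)"
    and "w \<in> lists (index A)"
  shows "\<phi> (artin_word A w) = artin_word B (word_subst g w)"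
  using assms(4)
proof (induction w)
  case Nil
  then show ?case using assms(1) by (simp add: artin_hom_def one_artin)
next
  case (Cons i w)
  have "\<phi> (artin_word A ([i] @ w)) = \<phi> (artin_gen A i \<otimes>\<^bsub>artin_monoid A\<^esub> artin_word A w)"
    unfolding artin_gen_def using Cons by (subst artin_word_mult) auto
  also have "\<dots> = \<phi> (artin_gen A i) \<otimes>\<^bsub>artin_monoid B\<^esub> \<phi> (artin_word A w)"
    using assms(1) Cons unfolding artin_hom_def artin_gen_def
    by (intro hom_mult[of \<phi> "artin_monoid A"] artin_word_carrier) auto
  also have "\<dots> = artin_word B (g i @ word_subst g w)"
    using Cons assms(2,3) word_subst_in_lists[of w "index A" g "index B"]
    by (simp add: artin_word_mult del: in_lists_conv_set)
  finally show ?case by simp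
qed

text \<open>Converse to \<open>artin_hom_induced\<close>. The braid relations that a homomorphism
  forces on the chosen words are the source of all arithmetic conditions on light
  homomorphisms.\<close>

lemma braid_hom_of_artin_hom:
  assumes "artin_hom A B \<phi>" "\<And>i. i \<in> index A \<Longrightarrow> g i \<in> lists (index B)"
    and "\<And>i. i \<in> index A \<Longrightarrow> \<phi> (artin_gen A i) = artin_word B (g i)"
  shows "braid_hom A B g"
proof -
  have "(word_subst g u, word_subst g v) \<in> braid_cong B" if uv: "(u, v) \<in> braid_relations A" for u v
  proof -
    from uv obtain i j n where *: "i \<in> index A" "j \<in> index A" "i \<noteq> j" "entry A i j = enat n"
      "u = alt_word n i j" "v = alt_word n j i" by (rule braid_relationsE)
    have l: "u \<in> lists (index A)" "v \<in> lists (index A)" using * by simp_all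
    have "artin_word A u = artin_word A v"
      using braid_relation_cong[OF *(1-4)] artin_word_eq_iff[OF l] * by simp
    moreover have "\<phi> (artin_word A w) = artin_word B (word_subst g w)" if "w \<in> lists (index A)" for w
      by (rule artin_hom_word[OF assms(1)]) (use assms that in auto)
    ultimately have "artin_word B (word_subst g u) = artin_word B (word_subst g v)"
      using l by metis
    moreover have "word_subst g u \<in> lists (index B)" "word_subst g v \<in> lists (index B)"
      by (rule word_subst_in_lists[OF l(1) assms(2)], assumption,
          rule word_subst_in_lists[OF l(2) assms(2)], assumption)
    ultimately show ?thesis by (simp only: artin_word_eq_iff)
  qed
  then show ?thesis using assms unfolding braid_hom_def artin_hom_def by blast
qed

lemma artin_hom_eq_induced:
  assumes "artin_hom A B \<phi>" "\<And>i. i \<in> index A \<Longrightarrow> g i \<in> lists (index B)"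
    and "\<And>i. i \<in> index A \<Longrightarrow> \<phi> (artin_gen A i) = artin_word B (g i)"
    and "x \<in> carrier (artin_monoid A)"
  shows "\<phi> x = induced_hom B g x"
proof -
  obtain w where w: "w \<in> lists (index A)" "x = artin_word A w"
    using assms(4) by (rule artin_carrierE)
  have "\<phi> (artin_word A w) = artin_word B (word_subst g w)"
    by (rule artin_hom_word) (use assms w in auto)
  moreover have "braid_hom A B g" by (rule braid_hom_of_artin_hom) (use assms in auto)
  ultimately show ?thesis unfolding w(2) by (simp only: induced_hom_word[OF _ w(1)])
qed

lemma braid_homI:
  assumes "is_coxeter_matrix A" "is_coxeter_matrix B" "\<And>i. i \<in> index A \<Longrightarrow> g i \<in> lists (index B)"
    and "\<And>i j n. \<lbrakk>i \<in> index A; j \<in> index A; i \<noteq> j; entry A i j = enat n\<rbrakk>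
      \<Longrightarrow> (word_subst g (alt_word n i j), word_subst g (alt_word n j i)) \<in> braid_cong B"
  shows "braid_hom A B g"
  unfolding braid_hom_def using assms(1-3) by (auto elim!: braid_relationsE intro: assms(4))

lemma braid_hom_comp:
  assumes "braid_hom A B g" "braid_hom B C h"
  shows "braid_hom A C (\<lambda>i. word_subst h (g i))"
proof -
  have "(word_subst (\<lambda>i. word_subst h (g i)) u, word_subst (\<lambda>i. word_subst h (g i)) v) \<in> braid_cong C"
    if "(u, v) \<in> braid_relations A" for u v
  proof -
    have "(word_subst g u, word_subst g v) \<in> braid_cong B"
      using that assms(1) by (auto simp: braid_hom_def)
    from braid_hom_cong[OF assms(2) this] show ?thesis by (simp only: word_subst_comp)
  qed
  moreover have "word_subst h (g i) \<in> lists (index C)" if "i \<in> index A" for i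
    using that assms by (intro braid_hom_in_lists[OF assms(2)]) (simp add: braid_hom_def)
  ultimately show ?thesis using assms unfolding braid_hom_def by blast
qed

text \<open>If \<open>h\<close> identifies two letters, both sides of their relation become the same
  power; otherwise the relation follows from a shorter one of \<open>B\<close> whose length divides
  its length. This covers tautological homomorphisms, foldings and inclusions.\<close>

lemma braid_hom_letter:
  assumes "is_coxeter_matrix A" "is_coxeter_matrix B" "\<And>i. i \<in> index A \<Longrightarrow> h i \<in> index B"
    and "\<And>i j. \<lbrakk>i \<in> index A; j \<in> index A; i \<noteq> j; h i \<noteq> h j\<rbrakk>
      \<Longrightarrow> entry B (h i) (h j) dvd entry A i j"
  shows "braid_hom A B (\<lambda>i. [h i])"
proof (rule braid_homI)
  fix i j n assume *: "i \<in> index A" "j \<in> index A" "i \<noteq> j" "entry A i j = enat n"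
  have sub: "word_subst (\<lambda>i. [h i]) w = map h w" for w by (induction w) auto
  show "(word_subst (\<lambda>i. [h i]) (alt_word n i j), word_subst (\<lambda>i. [h i]) (alt_word n j i)) \<in> braid_cong B"
  proof (cases "h i = h j")
    case True
    have "alt_word n (h j) (h j) \<in> lists (index B)" using * assms(3) by simp
    then show ?thesis unfolding sub unfolding map_alt_word True by (rule word_cong.refl)
  next
    case False
    from assms(4)[OF *(1-3) False] obtain c where c: "enat n = entry B (h i) (h j) * c"
      using * by (auto simp: dvd_def)
    have "2 \<le> enat n" using assms(1) * unfolding is_coxeter_matrix_def by metis
    \<comment> \<open>In \<open>enat\<close> the product of infinity and 0 is 0, so only a positive
      finite product guarantees that both factors are finite.\<close>
    then have "n \<noteq> 0" by (auto simp: numeral_eq_enat)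
    then obtain m k where mk: "entry B (h i) (h j) = enat m" "n = k * m"
      using c by (cases "entry B (h i) (h j)"; cases c)
         (auto simp: zero_enat_def times_enat_def split: if_splits)
    have "h i \<in> index B" "h j \<in> index B" using * assms(3) by auto
    from alt_word_cong_multiple[OF braid_relation_cong[OF this False mk(1)] this, of k]
    show ?thesis unfolding sub unfolding map_alt_word mk(2) .
  qed
qed (use assms in auto)

section \<open>Calculus of compositions\<close>

lemma composition_of_cong:
  assumes "composition_of K A B \<phi>" "\<And>x. x \<in> carrier (artin_monoid A) \<Longrightarrow> \<chi> x = \<phi> x"
  shows "composition_of K A B \<chi>"
  using assms(1)
proof cases
  case (single \<phi>')
  then show ?thesis using assms(2) by (intro composition_of.single[of K A B \<phi>']) auto
next
  case (compose B' \<phi>' \<psi>)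
  then show ?thesis using assms(2) by (intro composition_of.compose[of K A B' \<phi>' B \<psi>]) auto
qed

lemma composition_of_artin_hom_closed:
  assumes "composition_of K A B \<phi>" "\<And>A B \<phi>. K A B \<phi> \<Longrightarrow> artin_hom A B \<phi>"
    and "x \<in> carrier (artin_monoid A)"
  shows "\<phi> x \<in> carrier (artin_monoid B)"
  using assms(1,3)
  by (induction rule: composition_of.induct)
    (auto simp: artin_hom_def dest!: assms(2) intro: hom_in_carrier)

lemma composition_of_trans:
  assumes "composition_of K B C \<psi>" "composition_of K A B \<phi>" "\<And>A B \<phi>. K A B \<phi> \<Longrightarrow> artin_hom A B \<phi>"
  shows "composition_of K A C (\<lambda>x. \<psi> (\<phi> x))"
  using assms(1,2)
proof (induction rule: composition_of.induct)
  case (single B C \<psi> \<chi>)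
  show ?case
    using composition_of_artin_hom_closed[OF single(3) assms(3)] single(2)
    by (intro composition_of.compose[where K=K, OF single(3,1)]) auto
next
  case (compose B C \<phi>' D \<psi>' \<chi>)
  show ?case
    using composition_of_artin_hom_closed[OF compose(5) assms(3)] compose(3)
    by (intro composition_of.compose[where K=K, OF compose(4)[OF compose(5)] compose(2)]) auto
qed

text \<open>Used to replace every elementary factor by a composition of standard
  homomorphisms.\<close>

lemma composition_of_refine:
  assumes "composition_of K A B \<phi>" "\<And>A B \<phi>. K A B \<phi> \<Longrightarrow> composition_of L A B \<phi>"
    and "\<And>A B \<phi>. L A B \<phi> \<Longrightarrow> artin_hom A B \<phi>"
  shows "composition_of L A B \<phi>"
  using assms(1)
proof (induction rule: composition_of.induct)
  case (single A B \<phi> \<chi>)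
  then show ?case by (intro composition_of_cong[OF assms(2)]) auto
next
  case (compose A B \<phi> C \<psi> \<chi>)
  show ?case
    using compose(3)
    by (intro composition_of_cong[OF composition_of_trans[OF assms(2)[OF compose(2)] compose(4) assms(3)]])
      auto
qed

text \<open>Keeps a growing composite in the form \<open>induced_hom\<close>, so that it can finally
  be compared with a given homomorphism on generators alone.\<close>

lemma composition_of_induced_step:
  assumes "composition_of K A B (induced_hom B g)" "K B C (induced_hom C h)"
    and "braid_hom A B g" "braid_hom B C h"
  shows "composition_of K A C (induced_hom C (\<lambda>i. word_subst h (g i)))"
proof (rule composition_of.compose[where K=K, OF assms(1,2)], rule ballI)
  fix x assume "x \<in> carrier (artin_monoid A)"
  then obtain w where w: "w \<in> lists (index A)" "x = artin_word A w" by (rule artin_carrierE)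
  show "induced_hom C (\<lambda>i. word_subst h (g i)) x = induced_hom C h (induced_hom B g x)"
    unfolding w(2) induced_hom_word[OF assms(3) w(1)]
      induced_hom_word[OF assms(4) braid_hom_in_lists[OF assms(3) w(1)]]
      induced_hom_word[OF braid_hom_comp[OF assms(3,4)] w(1)] word_subst_comp ..
qed

section \<open>Braid relations between powers of two generators\<close>

lemma coxeter_entry_commute:
  "\<lbrakk>is_coxeter_matrix M; i \<in> index M; j \<in> index M\<rbrakk> \<Longrightarrow> entry M i j = entry M j i"
  unfolding is_coxeter_matrix_def by blast

lemma coxeter_entry_finite_ge_2:
  assumes "is_coxeter_matrix M" "i \<in> index M" "j \<in> index M" "i \<noteq> j" "entry M i j = enat n"
  shows "2 \<le> n"
proof -
  have "2 \<le> enat n" using assms unfolding is_coxeter_matrix_def by metis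
  then show ?thesis by (simp add: numeral_eq_enat)
qed

lemma set_alt_word_ge_2: "2 \<le> n \<Longrightarrow> set (alt_word n i j) = {i, j}"
proof -
  assume "2 \<le> n"
  then obtain k where "n = Suc (Suc k)" by (metis Suc_le_D numeral_2_eq_2 Suc_le_mono)
  then show ?thesis using set_alt_word[of k i j] by auto
qed

text \<open>Both sides of a braid relation have length at least two and hence the same set of
  letters. A chain of moves starting at a word over a subset therefore never leaves that subset, and
  every move in it is available in the submatrix.\<close>

lemma braid_cong_restrict:
  assumes "is_coxeter_matrix M" "is_submatrix N M"
    and "(u, v) \<in> braid_cong M" "u \<in> lists (index N)"
  shows "(u, v) \<in> braid_cong N"
proof -
  \<comment> \<open>The equivalence is carried along because the symmetric and transitive cases need
    to know that the other words also lie over \<open>index N\<close>.\<close>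
  have "(u \<in> lists (index N) \<longleftrightarrow> v \<in> lists (index N)) \<and>
      (u \<in> lists (index N) \<longrightarrow> (u, v) \<in> braid_cong N)"
    using assms(3)
  proof (induction rule: word_cong.induct)
    case (rel u v p q)
    from rel(1) obtain i j n where *: "i \<in> index M" "j \<in> index M" "i \<noteq> j" "entry M i j = enat n"
      "u = alt_word n i j" "v = alt_word n j i" by (rule braid_relationsE)
    have n: "2 \<le> n" using coxeter_entry_finite_ge_2[OF assms(1) *(1-4)] .
    have sets: "set u = {i, j}" "set v = {i, j}" 
      using * set_alt_word_ge_2[OF n, of i j] set_alt_word_ge_2[OF n, of j i] by auto
    have "(p @ u @ q, p @ v @ q) \<in> braid_cong N" if "p @ u @ q \<in> lists (index N)"
    proof -
      have ij: "i \<in> index N" "j \<in> index N" using that sets by (auto simp: in_lists_conv_set)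
      then have "entry N i j = enat n" using assms(2) * unfolding is_submatrix_def by auto
      from braid_relation_cong[OF ij *(3) this] show ?thesis
        unfolding *(5,6) by (rule word_cong_context) (use that in auto)
    qed
    then show ?case using sets by (auto simp: in_lists_conv_set)
  qed (auto intro: word_cong.intros)
  then show ?thesis using assms(4) by blast
qed

lemma braid_cong_length:
  "(u, v) \<in> braid_cong M \<Longrightarrow> length u = length v"
  by (erule word_cong_induct_invariant[where f = length]) (auto elim!: braid_relationsE)

lemma additive_concat_alt_word:
  fixes f :: "'a list \<Rightarrow> nat"
  assumes "f [] = 0" "\<And>u v. f (u @ v) = f u + f v"
  shows "f (concat (alt_word n x y)) = (Suc n div 2) * f x + (n div 2) * f y"
proof (induction n arbitrary: x y)
  case (Suc n)
  have "f (concat (alt_word (Suc n) x y)) = f x + f (concat (alt_word n y x))"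
    using assms(2) by simp
  then show ?case unfolding Suc by simp
qed (simp add: assms(1))

text \<open>For odd \<open>n\<close> one side has one more copy of \<open>x\<close>, the other one
  more copy of \<open>y\<close>, and braid moves preserve length.\<close>

lemma alt_word_swap_length:
  assumes "(concat (alt_word n x y), concat (alt_word n y x)) \<in> braid_cong M" "odd n"
  shows "length x = length y"
proof -
  obtain k where k: "n = Suc (2 * k)" using assms(2) by (elim oddE) simp
  show ?thesis
    using braid_cong_length[OF assms(1)]
      additive_concat_alt_word[of length n x y] additive_concat_alt_word[of length n y x] k by auto
qed

text \<open>Makes results about an even number of blocks available for an odd number.\<close>

lemma alt_word_swap_double:
  assumes "(concat (alt_word n x y), concat (alt_word n y x)) \<in> word_cong I R"
  shows "(concat (alt_word (2 * n) x y), concat (alt_word (2 * n) y x)) \<in> word_cong I R"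
  using word_cong_append[OF assms assms] word_cong_append[OF assms word_cong.sym[OF assms]]
  by (cases "even n") (simp_all add: mult_2 alt_word_add del: map_concat)

text \<open>The reflections \<open>x \<mapsto> -x\<close> and \<open>x \<mapsto> 1 - x\<close> of \<open>\<int>/m\<close> generate a dihedral group of order \<open>2m\<close>;
  for \<open>m = 0\<close> this is the infinite dihedral group.\<close>

definition dihedral_act :: "'a \<Rightarrow> 'a list \<Rightarrow> int \<Rightarrow> int" where
  "dihedral_act a = foldr (\<lambda>x t. if x = a then - t else 1 - t)"

lemma dihedral_act_append: "dihedral_act a (u @ v) t = dihedral_act a u (dihedral_act a v t)"
  by (simp add: dihedral_act_def)

lemma dihedral_act_cong:
  "[t = t'] (mod m) \<Longrightarrow> [dihedral_act a w t = dihedral_act a w t'] (mod m)"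
proof (induction w)
  case (Cons x w)
  then have "[dihedral_act a w t = dihedral_act a w t'] (mod m)" by blast
  then have "[- dihedral_act a w t = - dihedral_act a w t'] (mod m)"
    "[1 - dihedral_act a w t = 1 - dihedral_act a w t'] (mod m)"
    by (simp_all add: cong_minus_minus_iff cong_diff)
  then show ?case by (simp add: dihedral_act_def)
qed (simp add: dihedral_act_def)

text \<open>Prepending a letter to each word exchanges the roles of the two words and, through the
  constant 1 in \<open>1 - t\<close>, raises the difference by one.\<close>

lemma dihedral_act_alt_word:
  assumes "a \<noteq> b"
  shows "dihedral_act a (alt_word n b a) t - dihedral_act a (alt_word n a b) t = int n"
  by (induction n) (use assms in \<open>simp_all add: dihedral_act_def\<close>)

text \<open>By \<open>dihedral_act_alt_word\<close> the two words act on the integers with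
  difference exactly \<open>n\<close>, and congruent words act equally modulo the entry.\<close>

lemma alt_word_swap_dvd:
  assumes "index N = {a, b}" "a \<noteq> b" "is_coxeter_matrix N"
    and "(alt_word n a b, alt_word n b a) \<in> braid_cong N"
  shows "entry N a b dvd enat n"
proof -
  \<comment> \<open>Modulus 0 stands for the entry infinity: congruence modulo 0 is equality, and 0
    divides only 0.\<close>
  define m where "m = (case entry N a b of enat k \<Rightarrow> int k | \<infinity> \<Rightarrow> 0)"
  have comm: "entry N b a = entry N a b"
    using coxeter_entry_commute[OF assms(3)] assms(1) by blast
  have "(\<lambda>t. dihedral_act a (alt_word n a b) t mod m) = (\<lambda>t. dihedral_act a (alt_word n b a) t mod m)"
    using assms(4)
  proof (rule word_cong_induct_invariant)
    fix u v p q assume "(u, v) \<in> braid_relations N"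
    then obtain i j k where *: "i \<in> index N" "j \<in> index N" "i \<noteq> j" "entry N i j = enat k"
      "u = alt_word k i j" "v = alt_word k j i" by (rule braid_relationsE)
    have m: "m = int k" and ij: "(i = a \<and> j = b) \<or> (i = b \<and> j = a)"
      using * assms(1) comm by (auto simp: m_def)
    have "[dihedral_act a (alt_word k b a) t = dihedral_act a (alt_word k a b) t] (mod m)" for t
      using dihedral_act_alt_word[OF assms(2), of k t] by (simp add: cong_iff_dvd_diff m)
    then have "[dihedral_act a u t = dihedral_act a v t] (mod m)" for t
      using ij cong_sym unfolding *(5,6) by blast
    then have "[dihedral_act a (p @ u @ q) t = dihedral_act a (p @ v @ q) t] (mod m)" for t
      unfolding dihedral_act_append by (intro dihedral_act_cong)
    then show "(\<lambda>t. dihedral_act a (p @ u @ q) t mod m) = (\<lambda>t. dihedral_act a (p @ v @ q) t mod m)"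
      by (simp add: cong_def)
  qed
  then have "[dihedral_act a (alt_word n b a) 0 = dihedral_act a (alt_word n a b) 0] (mod m)"
    unfolding cong_def by metis
  then have "m dvd int n"
    using dihedral_act_alt_word[OF assms(2), of n 0] by (simp add: cong_iff_dvd_diff)
  then show ?thesis
  proof (cases "entry N a b")
    case (enat k)
    then obtain c where "n = k * c" using \<open>m dvd int n\<close> by (auto simp: m_def)
    then show ?thesis unfolding enat by (intro dvdI[of _ _ "enat c"]) simp
  next
    case infinity
    then have "enat n = \<infinity> * 0" using \<open>m dvd int n\<close> by (simp add: m_def zero_enat_def)
    then show ?thesis unfolding infinity by (rule dvdI)
  qed
qed

text \<open>The only relation exchanges two letters, so the number of letters \<open>a\<close> is
  invariant; for odd \<open>n\<close> the two words differ by \<open>p\<close> in this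
  number.\<close>

lemma commuting_blocks_even:
  assumes "index N = {a, b}" "a \<noteq> b" "is_coxeter_matrix N" "entry N a b = 2" "0 < p"
    and "(concat (alt_word n (replicate p a) (replicate q b)),
      concat (alt_word n (replicate q b) (replicate p a))) \<in> braid_cong N"
  shows "even n"
proof -
  have comm: "entry N b a = entry N a b"
    using coxeter_entry_commute[OF assms(3)] assms(1) by blast
  have add: "count_list [] a = 0" "\<And>u v. count_list (u @ v) a = count_list u a + count_list v a"
    by auto
  have rep: "count_list (replicate k x) a = (if x = a then k else 0)" for k x
    by (induction k) auto
  have "count_list (concat (alt_word n (replicate p a) (replicate q b))) a =
      count_list (concat (alt_word n (replicate q b) (replicate p a))) a"
    using assms(6)
  proof (rule word_cong_induct_invariant)
    fix u v r s assume "(u, v) \<in> braid_relations N"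
    then obtain i j k where *: "i \<in> index N" "j \<in> index N" "i \<noteq> j" "entry N i j = enat k"
      "u = alt_word k i j" "v = alt_word k j i" by (rule braid_relationsE)
    then have "k = 2" using assms(1,4) comm by (auto simp: numeral_eq_enat)
    then show "count_list (r @ u @ s) a = count_list (r @ v @ s) a"
      using * by (simp add: numeral_2_eq_2)
  qed
  then show ?thesis
    using assms(2,5)
      additive_concat_alt_word[of "\<lambda>w. count_list w a" n "replicate p a" "replicate q b", OF add]
      additive_concat_alt_word[of "\<lambda>w. count_list w a" n "replicate q b" "replicate p a", OF add]
    by (cases "even n") (auto simp: rep elim!: oddE)
qed

text \<open>The braid group on three strands acts on \<open>\<int>\<^sup>2\<close> through \<open>SL\<^sub>2(\<int>)\<close>, the generators acting as
  transvections.\<close>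

definition sl2_act :: "'a \<Rightarrow> 'a list \<Rightarrow> int \<times> int \<Rightarrow> int \<times> int" where
  "sl2_act a = foldr (\<lambda>x (s, t). if x = a then (s + t, t) else (s, t - s))"

lemma sl2_act_append: "sl2_act a (u @ v) z = sl2_act a u (sl2_act a v z)"
  by (simp add: sl2_act_def)

lemma sl2_act_replicate:
  "sl2_act a (replicate p a) (s, t) = (s + int p * t, t)"
  "b \<noteq> a \<Longrightarrow> sl2_act a (replicate p b) (s, t) = (s, t - int p * s)"
  by (induction p) (auto simp: sl2_act_def algebra_simps)

lemma sl2_act_braid_cong:
  assumes "index N = {a, b}" "a \<noteq> b" "is_coxeter_matrix N" "entry N a b = 3"
    and "(u, v) \<in> braid_cong N"
  shows "sl2_act a u z = sl2_act a v z"
proof -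
  have comm: "entry N b a = entry N a b"
    using coxeter_entry_commute[OF assms(3)] assms(1) by blast
  have "sl2_act a u = sl2_act a v"
    using assms(5)
  proof (rule word_cong_induct_invariant)
    fix u v r s assume "(u, v) \<in> braid_relations N"
    then obtain i j k where *: "i \<in> index N" "j \<in> index N" "i \<noteq> j" "entry N i j = enat k"
      "u = alt_word k i j" "v = alt_word k j i" by (rule braid_relationsE)
    have "k = 3" using * assms(1,4) comm by (auto simp: numeral_eq_enat)
    moreover have "(i = a \<and> j = b) \<or> (i = b \<and> j = a)" using * assms(1) by auto
    ultimately have "sl2_act a u z = sl2_act a v z" for z
      using *(5,6) assms(2) by (auto simp: numeral_3_eq_3 sl2_act_def split: prod.splits)
    then show "sl2_act a (r @ u @ s) = sl2_act a (r @ v @ s)"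
      by (simp add: fun_eq_iff sl2_act_append)
  qed
  then show ?thesis by simp
qed

text \<open>Write \<open>X\<close> and \<open>Y\<close> for the two blocks. The relation makes the
  vector \<open>(XY)^k (1, 0)\<close> fixed by the transvection \<open>X\<close>, so its second
  coordinate \<open>y k\<close> is 0. As \<open>XY\<close> has determinant 1 and trace
  \<open>2 - p q\<close>, the sequence \<open>y\<close> satisfies a linear recurrence; its zeros
  have period 2 or 3 when \<open>p q\<close> is 2 or 3, and 0 is the only zero when
  \<open>p q\<close> is at least 4.\<close>

lemma sl2_blocks:
  assumes "index N = {a, b}" "a \<noteq> b" "is_coxeter_matrix N" "entry N a b = 3" "0 < p" "0 < q"
    and "(concat (alt_word (2 * k) (replicate p a) (replicate q b)),
      concat (alt_word (2 * k) (replicate q b) (replicate p a))) \<in> braid_cong N"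
  shows "p * q = 2 \<Longrightarrow> 2 dvd k" "p * q = 3 \<Longrightarrow> 3 dvd k" "4 \<le> p * q \<Longrightarrow> k = 0"
proof -
  let ?X = "replicate p a" and ?Y = "replicate q b"
  define z where "z k = sl2_act a (concat (alt_word (2 * k) ?X ?Y)) (1, 0)" for k
  define y where "y k = snd (z k)" for k
  have z0: "z 0 = (1, 0)" by (simp add: z_def sl2_act_def)
  have zSuc: "z (Suc k) = (case z k of (s, t) \<Rightarrow> (s + int p * (t - int q * s), t - int q * s))" for k
    using assms(2) by (auto simp: z_def sl2_act_append sl2_act_replicate split: prod.splits)
  have y0: "y 0 = 0" and y1: "y (Suc 0) = - int q"
    by (simp_all add: y_def z0 zSuc)
  have rec: "y (Suc (Suc k)) = (2 - int (p * q)) * y (Suc k) - y k" for k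
    by (auto simp: y_def zSuc algebra_simps split: prod.splits)
  \<comment> \<open>The word \<open>(XY)^k X\<close> is also \<open>X (YX)^k\<close>. Its first form
    is evaluated using that \<open>X\<close> fixes \<open>(1, 0)\<close>, its second using the
    assumed congruence.\<close>
  have "concat (alt_word (2 * k) ?X ?Y @ [?X]) = concat (alt_word (Suc (2 * k)) ?X ?Y)"
    using alt_word_add[of "2 * k" 1 ?X ?Y] by simp
  then have "sl2_act a (concat (alt_word (2 * k) ?X ?Y)) (sl2_act a ?X (1, 0)) =
      sl2_act a ?X (sl2_act a (concat (alt_word (2 * k) ?Y ?X)) (1, 0))"
    by (simp add: sl2_act_append flip: sl2_act_append[of a "concat (alt_word (2 * k) ?X ?Y)"])
  then have "z k = sl2_act a ?X (z k)"
    using sl2_act_braid_cong[OF assms(1-4,7), of "(1, 0)"] by (simp add: z_def sl2_act_replicate)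
  then have yk: "y k = 0"
    using assms(5) by (cases "z k") (auto simp: y_def sl2_act_replicate)
  show "2 dvd k" if "p * q = 2"
  proof (rule ccontr)
    assume "\<not> 2 dvd k"
    moreover have "y (Suc (2 * j)) \<noteq> 0" for j
      by (induction j) (use that rec y1 assms(6) in auto)
    ultimately show False using yk by (auto elim!: oddE)
  qed
  show "3 dvd k" if "p * q = 3"
  proof -
    have "y (3 * j) = 0 \<and> y (Suc (3 * j)) = - int q \<and> y (Suc (Suc (3 * j))) = int q" for j
      using that by (induction j) (simp_all add: rec y0 y1 numeral_3_eq_3)
    then have "y (3 * j + 1) \<noteq> 0" "y (3 * j + 2) \<noteq> 0" for j
      using assms(6) by simp_all
    moreover have "k = 3 * (k div 3) \<or> k = 3 * (k div 3) + 1 \<or> k = 3 * (k div 3) + 2" by arith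
    ultimately show ?thesis using yk by (metis dvd_triv_left)
  qed
  show "k = 0" if "4 \<le> p * q"
  proof (rule ccontr)
    assume "k \<noteq> 0"
    \<comment> \<open>The coefficient of the recurrence has absolute value at least 2, so a sequence
      that starts to grow keeps growing.\<close>
    have "\<bar>y j\<bar> < \<bar>y (Suc j)\<bar>" for j
    proof (induction j)
      case 0
      then show ?case using y0 y1 assms(6) by simp
    next
      case (Suc j)
      have "2 * \<bar>y (Suc j)\<bar> \<le> \<bar>(2 - int (p * q)) * y (Suc j)\<bar>"
        unfolding abs_mult
      proof (rule mult_right_mono)
        show "2 \<le> \<bar>2 - int (p * q)\<bar>" using that by linarith
      qed simp
      then show ?case using Suc unfolding rec by linarith
    qed
    from this[of "k - 1"] show False using yk \<open>k \<noteq> 0\<close> by simp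
  qed
qed

text \<open>A word without the factor \<open>bab\<close> admits no braid move of length at least four, so it is alone
  in its congruence class.\<close>

lemma braid_cong_rigid:
  assumes "index N = {a, b}" "is_coxeter_matrix N" "4 \<le> entry N a b"
    and "(u, v) \<in> braid_cong N" "\<not> sublist [b, a, b] u"
  shows "u = v"
proof -
  have comm: "entry N b a = entry N a b"
    using coxeter_entry_commute[OF assms(2)] assms(1) by blast
  \<comment> \<open>The disjunction makes the claim symmetric in the two words, as the induction
    over symmetry and transitivity requires.\<close>
  have "\<not> sublist [b, a, b] u \<or> \<not> sublist [b, a, b] v \<longrightarrow> u = v"
    using assms(4)
  proof (induction rule: word_cong.induct)
    case (rel u v p q)
    from rel(1) obtain i j k where *: "i \<in> index N" "j \<in> index N" "i \<noteq> j" "entry N i j = enat k"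
      "u = alt_word k i j" "v = alt_word k j i" by (rule braid_relationsE)
    have ij: "(i = a \<and> j = b) \<or> (i = b \<and> j = a)" using * assms(1) by auto
    have "4 \<le> k" using ij *(4) assms(3) comm by (auto simp: numeral_eq_enat)
    then obtain l where "k = 4 + l" using le_Suc_ex by blast
    then have l: "k = Suc (Suc (Suc (Suc l)))" by simp
    have "sublist [b, a, b] u" "sublist [b, a, b] v"
      using ij unfolding *(5,6) l by (auto simp: sublist_Cons_right)
    then have "sublist [b, a, b] (p @ u @ q)" "sublist [b, a, b] (p @ v @ q)"
      by (auto intro: sublist_order.order.trans[OF _ sublist_appendI])
    then show ?case by blast
  qed auto
  then show ?thesis using assms(5) by blast
qed

text \<open>The factor \<open>bab\<close> contains an isolated \<open>a\<close>, but in these words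
  the letters \<open>a\<close> come in runs of length at least \<open>p\<close>.\<close>

lemma not_sublist_blocks:
  assumes "a \<noteq> b" "2 \<le> p"
  shows "\<not> sublist [b, a, b] (concat (alt_word n (replicate p a) (replicate q b)))"
    and "\<not> sublist [b, a, b] (concat (alt_word n (replicate q b) (replicate p a)))"
proof -
  obtain r where p: "p = Suc (Suc r)" using assms(2) by (metis Suc_le_D numeral_2_eq_2 Suc_le_mono)
  have A: "\<not> sublist [b, a, b] (replicate k a @ w)" if "\<not> sublist [b, a, b] w" for k w
    using assms(1) that by (induction k) (auto simp: sublist_Cons_right)
  \<comment> \<open>A new factor \<open>bab\<close> would have to start at the last prepended
    \<open>b\<close>, and the double \<open>a\<close> following it prevents this.\<close>
  have B: "\<not> sublist [b, a, b] (replicate k b @ w)"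
    if "\<not> sublist [b, a, b] w" "w = [] \<or> (\<exists>w'. w = a # a # w')" for k w
    using that
  proof (induction k)
    case (Suc k)
    then show ?case using assms(1) by (cases k) (auto simp: sublist_Cons_right)
  qed simp
  have start: "concat (alt_word k (replicate p a) y) = [] \<or>
      (\<exists>w'. concat (alt_word k (replicate p a) y) = a # a # w')" for k y
    by (cases k) (auto simp: p)
  have "\<not> sublist [b, a, b] (concat (alt_word n (replicate p a) (replicate q b))) \<and>
    \<not> sublist [b, a, b] (concat (alt_word n (replicate q b) (replicate p a)))"
  proof (induction n)
    case (Suc n)
    then show ?case
      using A[of "concat (alt_word n (replicate q b) (replicate p a))" p]
        B[OF _ start, of n "replicate q b" q] by simp
  qed simp
  then show "\<not> sublist [b, a, b] (concat (alt_word n (replicate p a) (replicate q b)))"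
    and "\<not> sublist [b, a, b] (concat (alt_word n (replicate q b) (replicate p a)))" by auto
qed

text \<open>By rigidity the two words would be equal, but their first letters differ.\<close>

lemma no_swap_of_thick_blocks:
  assumes "index N = {a, b}" "a \<noteq> b" "is_coxeter_matrix N" "4 \<le> entry N a b" "2 \<le> p" "0 < q" "0 < n"
  shows "(concat (alt_word n (replicate p a) (replicate q b)),
      concat (alt_word n (replicate q b) (replicate p a))) \<notin> braid_cong N"
proof
  assume "(concat (alt_word n (replicate p a) (replicate q b)),
      concat (alt_word n (replicate q b) (replicate p a))) \<in> braid_cong N"
  from braid_cong_rigid[OF assms(1,3,4) this not_sublist_blocks(1)[OF assms(2,5)]]
  have "hd (concat (alt_word n (replicate p a) (replicate q b))) =
      hd (concat (alt_word n (replicate q b) (replicate p a)))" by simp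
  moreover obtain p' q' n' where "p = Suc p'" "q = Suc q'" "n = Suc n'"
    using assms(5-7) by (metis Suc_le_D gr0_implies_Suc numeral_2_eq_2)
  ultimately show False using assms(2) by simp
qed

text \<open>After restriction to two letters, the case \<open>p q = 1\<close> uses the dihedral
  action, a commuting pair the letter count, the entry 3 the action of \<open>SL_2\<close>, and
  larger entries rigidity. Where the Tits entry is infinite, the assumed congruence is
  contradictory.\<close>

lemma tits_entry_dvd_of_block_swap:
  assumes "is_coxeter_matrix M" "a \<in> index M" "b \<in> index M" "a \<noteq> b" "0 < p" "0 < q" "0 < n"
    and "(concat (alt_word n (replicate p a) (replicate q b)),
      concat (alt_word n (replicate q b) (replicate p a))) \<in> braid_cong M"
  shows "tits_entry (entry M a b) p q dvd enat n"
proof -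
  define N where "N = M\<lparr>index := {a, b}\<rparr>"
  have N: "index N = {a, b}" "entry N = entry M" "is_coxeter_matrix N" "is_submatrix N M"
    using assms(1-3) by (auto simp: N_def is_coxeter_matrix_def is_submatrix_def)
  have "concat (alt_word n (replicate p a) (replicate q b)) \<in> lists (index N)"
    using set_alt_word[of n "replicate p a" "replicate q b"] by (fastforce simp: N(1))
  from braid_cong_restrict[OF assms(1) N(4) assms(8) this]
  have rel: "(concat (alt_word n (replicate p a) (replicate q b)),
      concat (alt_word n (replicate q b) (replicate p a))) \<in> braid_cong N" .
  have comm: "entry M b a = entry M a b" by (rule coxeter_entry_commute[OF assms(1,3,2)])
  have ge2: "2 \<le> entry M a b" using assms(1-4) unfolding is_coxeter_matrix_def by blast
  have dvd: "enat k dvd enat n" if "k dvd n" for k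
    using that by (metis dvd_def times_enat_simps(1))
  consider "p * q = 1" | "p * q \<noteq> 1" "entry M a b = 2" | "2 \<le> p * q" "entry M a b = 3"
    | "2 \<le> p * q" "4 \<le> entry M a b"
  proof -
    have "entry M a b = 2 \<or> entry M a b = 3 \<or> 4 \<le> entry M a b"
      using ge2 by (cases "entry M a b") (auto simp: numeral_eq_enat)
    moreover have "p * q = 1 \<or> 2 \<le> p * q" using assms(5,6) by (cases "p * q") auto
    ultimately show ?thesis using that by fastforce
  qed
  then show ?thesis
  proof cases
    case 1
    then have pq: "p = 1" "q = 1" by auto
    have single: "concat (alt_word n [x] [y]) = alt_word n x y" for x y :: 'a
      by (induction n arbitrary: x y) auto
    show ?thesis
      using alt_word_swap_dvd[OF N(1) assms(4) N(3)] rel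
      by (simp add: pq single N(2) tits_entry_def)
  next
    case 2
    have "even n" by (rule commuting_blocks_even[OF N(1) assms(4) N(3) _ assms(5) rel]) (simp add: N 2)
    then show ?thesis using dvd[of 2] 2 by (simp add: tits_entry_def numeral_eq_enat)
  next
    case 3
    have N3: "entry N a b = 3" using 3 N by simp
    have len: "odd n \<Longrightarrow> p = q" using alt_word_swap_length[OF rel] by simp
    have even: "even n"
    proof (rule ccontr)
      assume "odd n"
      \<comment> \<open>Odd \<open>n\<close> forces \<open>p = q\<close>, so a product at least 2 is
        at least 4; the doubled relation then falls under the growing case of
        \<open>sl2_blocks\<close>.\<close>
      then have "4 \<le> p * q" using len 3(1) by (cases p; cases "p - 1") auto
      with sl2_blocks(3)[OF N(1) assms(4) N(3) N3 assms(5,6) alt_word_swap_double[OF rel]]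
      show False using assms(7) by simp
    qed
    then obtain k where k: "n = 2 * k" by (elim evenE)
    note sl2 = sl2_blocks[OF N(1) assms(4) N(3) N3 assms(5,6) rel[unfolded k]]
    have "p * q = 2 \<or> p * q = 3" using sl2(3) 3(1) assms(7) k by fastforce
    then have "2 * p * q dvd n" using sl2(1,2) k by (auto simp: mult.assoc)
    then show ?thesis
      using \<open>p * q = 2 \<or> p * q = 3\<close> dvd[of "2 * p * q"] 3 by (auto simp: tits_entry_def mult.assoc numeral_eq_enat)
  next
    case 4
    have "2 \<le> p \<or> 2 \<le> q" using 4(1) assms(5,6) by (cases "p = 1"; cases "q = 1") auto
    then show ?thesis
    proof
      assume "2 \<le> p"
      from no_swap_of_thick_blocks[OF N(1) assms(4) N(3) _ this assms(6,7)] rel 4 N show ?thesis by simp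
    next
      assume "2 \<le> q"
      \<comment> \<open>The rigidity argument wants the thick block at the first letter, so the two
        letters are exchanged.\<close>
      from no_swap_of_thick_blocks[of N b a q p n] this rel[THEN word_cong.sym] 4 N comm assms
      show ?thesis by (simp add: insert_commute)
    qed
  qed
qed

section \<open>Products of commuting generators in a Coxeter group\<close>

text \<open>The geometric representation of the Coxeter group on the functions \<open>index M \<rightarrow> \<real>\<close>. On the
  diagonal \<open>- cos \<pi> = 1\<close>.\<close>

definition cos_form :: "'a coxeter_matrix \<Rightarrow> 'a \<Rightarrow> 'a \<Rightarrow> real" where
  "cos_form M i j = (case entry M i j of enat n \<Rightarrow> - cos (pi / real n) | \<infinity> \<Rightarrow> - 1)"

definition root_pairing :: "'a coxeter_matrix \<Rightarrow> 'a \<Rightarrow> ('a \<Rightarrow> real) \<Rightarrow> real" where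
  "root_pairing M i v = (\<Sum>k\<in>index M. cos_form M i k * v k)"

text \<open>The values of \<open>v\<close> are coordinates in the basis of simple roots. Subtracting
  a multiple of the root of \<open>i\<close> changes coordinate \<open>i\<close> only, which is what
  later detects the letters of a word.\<close>

definition geom_refl :: "'a coxeter_matrix \<Rightarrow> 'a \<Rightarrow> ('a \<Rightarrow> real) \<Rightarrow> 'a \<Rightarrow> real" where
  "geom_refl M i v = v(i := v i - 2 * root_pairing M i v)"

lemma root_pairing_geom_refl:
  assumes "finite (index M)" "i \<in> index M"
  shows "root_pairing M j (geom_refl M i v) =
    root_pairing M j v - 2 * cos_form M j i * root_pairing M i v"
proof -
  have "root_pairing M j (geom_refl M i v) =
      (\<Sum>k\<in>index M. cos_form M j k * v k - (if k = i then 2 * cos_form M j i * root_pairing M i v else 0))"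
    unfolding root_pairing_def[of M j]
    by (intro sum.cong) (auto simp: geom_refl_def algebra_simps)
  then show ?thesis
    using assms by (simp add: sum_subtractf root_pairing_def)
qed

lemma sin_step: "sin ((x + 1) * t) + sin ((x - 1) * t) = 2 * cos t * sin (x * t)" for x t :: real
  by (simp add: distrib_right left_diff_distrib sin_add sin_diff)

text \<open>Telescoping by the product-to-sum formula. For \<open>t = pi / n\<close> the factor
  \<open>sin (n t)\<close> vanishes, and with it the sum.\<close>

lemma sum_sin_arith:
  fixes a t :: real
  shows "sin t * (\<Sum>l<n. sin ((2 * real l + a) * t)) = sin (real n * t) * sin ((real n - 1 + a) * t)"
proof (induction n)
  case (Suc n)
  have "2 * (sin (real (Suc n) * t) * sin ((real (Suc n) - 1 + a) * t)) -
      2 * (sin (real n * t) * sin ((real n - 1 + a) * t)) = 2 * (sin t * sin ((2 * real n + a) * t))"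
  proof -
    have prod: "2 * (sin x * sin y) = cos (x - y) - cos (x + y)" for x y :: real
      by (simp add: cos_diff cos_add)
    have "real (Suc n) * t - (real (Suc n) - 1 + a) * t = t - a * t"
      "real (Suc n) * t + (real (Suc n) - 1 + a) * t = t + (2 * real n + a) * t"
      "real n * t - (real n - 1 + a) * t = t - a * t"
      "real n * t + (real n - 1 + a) * t = - (t - (2 * real n + a) * t)"
      by (simp_all add: algebra_simps)
    then show ?thesis unfolding prod by (simp del: of_nat_Suc minus_diff_eq)
  qed
  then show ?case using Suc by (simp add: distrib_left)
qed simp

text \<open>Instead of taking powers of a matrix, the proof follows the root pairings along the
  orbit of \<open>v\<close>. They are combinations of sines in arithmetic progression; the total
  displacement of \<open>v\<close> after \<open>n\<close> rounds is given by their sums, which are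
  0.\<close>

lemma geom_refl_relation_order:
  assumes "is_coxeter_matrix M" "i \<in> index M" "j \<in> index M" "i \<noteq> j" "entry M i j = enat n"
  shows "foldr (geom_refl M) (concat (replicate n [i, j])) v = v"
proof -
  define t where "t = pi / real n"
  define c where "c = cos t"
  have fin: "finite (index M)" using assms(1) unfolding is_coxeter_matrix_def by blast
  have n: "2 \<le> n" using coxeter_entry_finite_ge_2[OF assms] .
  have sin_t: "sin t \<noteq> 0"
    using n unfolding t_def by (intro less_imp_neq[symmetric] sin_gt_zero) (auto simp: field_simps)
  have sin_nt: "sin (real n * t) = 0" using n unfolding t_def by simp
  have "entry M j i = enat n" "entry M i i = enat 1" "entry M j j = enat 1"
    using coxeter_entry_commute[OF assms(1,2,3)] assms
    unfolding is_coxeter_matrix_def by (auto simp: one_enat_def)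
  then have form: "cos_form M i j = - c" "cos_form M j i = - c" "cos_form M i i = 1" "cos_form M j j = 1"
    using assms(5) by (simp_all add: cos_form_def c_def t_def)
  define V where "V k = foldr (geom_refl M) (concat (replicate k [i, j])) v" for k
  define q where "q k = root_pairing M j (V k)" for k
  \<comment> \<open>This is the pairing with \<open>i\<close> halfway through round
    \<open>k\<close>, after the reflection in \<open>j\<close>; see \<open>r_alt\<close>.\<close>
  define r where "r k = root_pairing M i (V k) + 2 * c * q k" for k
  have V0: "V 0 = v" and VSuc: "V (Suc k) = geom_refl M i (geom_refl M j (V k))" for k
    by (simp_all add: V_def)
  have r_alt: "root_pairing M i (geom_refl M j (V k)) = r k" for k
    using root_pairing_geom_refl[OF fin assms(3), of i] by (simp add: form r_def q_def)
  have qSuc: "q (Suc k) = 2 * c * r k - q k" for k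
    unfolding q_def VSuc
    using root_pairing_geom_refl[OF fin assms(2), of j "geom_refl M j (V k)"]
      root_pairing_geom_refl[OF fin assms(3), of j "V k"]
    by (simp add: form r_alt)
  have rSuc: "r (Suc k) = 2 * c * q (Suc k) - r k" for k
    unfolding r_def[of "Suc k"] VSuc
    using root_pairing_geom_refl[OF fin assms(2), of i "geom_refl M j (V k)"]
    by (simp add: form r_alt)
  \<comment> \<open>The interleaved sequence \<open>q 0, r 0, q 1, r 1, ...\<close> satisfies one
    recurrence, in which each term is \<open>2 * c\<close> times the previous one minus the one
    before; \<open>sin_step\<close> is the same recurrence for sines.\<close>
  have closed: "sin t * q k = r 0 * sin (2 * real k * t) - q 0 * sin ((2 * real k - 1) * t) \<and>
      sin t * r k = r 0 * sin ((2 * real k + 1) * t) - q 0 * sin (2 * real k * t)" for k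
  proof (induction k)
    case (Suc k)
    define S0 where "S0 = sin (2 * real k * t)"
    define S1 where "S1 = sin ((2 * real k + 1) * t)"
    define S2 where "S2 = sin (2 * real (Suc k) * t)"
    define S3 where "S3 = sin ((2 * real (Suc k) + 1) * t)"
    have e: "2 * real (Suc k) = (2 * real k + 1) + 1" "2 * real (Suc k) - 1 = 2 * real k + 1" by simp_all
    have s1: "sin ((2 * real k - 1) * t) = 2 * c * S0 - S1"
      using sin_step[of "2 * real k" t] by (simp add: S0_def S1_def c_def)
    have s2: "S2 = 2 * c * S1 - S0"
      using sin_step[of "2 * real k + 1" t] by (simp add: e(1) S0_def S1_def S2_def c_def)
    have s3: "S3 = 2 * c * S2 - S1"
      using sin_step[of "2 * real (Suc k)" t] unfolding e(2) S1_def S2_def S3_def c_def by linarith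
    have IH: "sin t * q k = r 0 * S0 - q 0 * (2 * c * S0 - S1)" "sin t * r k = r 0 * S1 - q 0 * S0"
      using Suc unfolding s1 S0_def[symmetric] S1_def[symmetric] by blast+
    have "sin t * q (Suc k) = 2 * c * (sin t * r k) - sin t * q k"
      by (simp add: qSuc algebra_simps)
    then have q: "sin t * q (Suc k) = r 0 * S2 - q 0 * S1"
      unfolding IH s2 by (simp add: algebra_simps)
    have "sin t * r (Suc k) = 2 * c * (sin t * q (Suc k)) - sin t * r k"
      by (simp add: rSuc algebra_simps)
    then have "sin t * r (Suc k) = r 0 * S3 - q 0 * S2"
      unfolding IH q s3 s2 by (simp add: algebra_simps)
    with q show ?case unfolding e(2) S1_def S2_def S3_def by blast
  qed simp
  have sum0: "(\<Sum>l<n. sin ((2 * real l + a) * t)) = 0" for a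
    using sum_sin_arith[where t = t and n = n and a = a] sin_nt sin_t by simp
  have "sin t * (\<Sum>l<n. q l) =
      r 0 * (\<Sum>l<n. sin ((2 * real l + 0) * t)) - q 0 * (\<Sum>l<n. sin ((2 * real l + (- 1)) * t))"
    unfolding sum_distrib_left sum_subtractf[symmetric] using closed by (intro sum.cong) auto
  then have sum_q: "(\<Sum>l<n. q l) = 0" using sin_t by (simp only: sum0) simp
  have "sin t * (\<Sum>l<n. r l) =
      r 0 * (\<Sum>l<n. sin ((2 * real l + 1) * t)) - q 0 * (\<Sum>l<n. sin ((2 * real l + 0) * t))"
    unfolding sum_distrib_left sum_subtractf[symmetric] using closed by (intro sum.cong) auto
  then have sum_r: "(\<Sum>l<n. r l) = 0" using sin_t by (simp only: sum0) simp
  have V: "V k = v(i := v i - 2 * (\<Sum>l<k. r l), j := v j - 2 * (\<Sum>l<k. q l))" for k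
  proof (induction k)
    case 0
    then show ?case by (simp add: V0)
  next
    case (Suc k)
    have "V (Suc k) = (V k)(j := V k j - 2 * q k, i := V k i - 2 * r k)"
      using assms(4) unfolding VSuc geom_refl_def[of M i] r_alt by (simp add: geom_refl_def q_def)
    then show ?case unfolding Suc using assms(4) by (auto simp: fun_eq_iff)
  qed
  show ?thesis using V[of n] sum_q sum_r by (simp add: V_def)
qed

lemma geom_refl_involution:
  assumes "is_coxeter_matrix M" "i \<in> index M"
  shows "geom_refl M i (geom_refl M i v) = v"
proof -
  have "finite (index M)" "entry M i i = enat 1"
    using assms unfolding is_coxeter_matrix_def by (auto simp: one_enat_def)
  then have "root_pairing M i (geom_refl M i v) = - root_pairing M i v"
    using root_pairing_geom_refl[of M i i v] assms(2) by (simp add: cos_form_def)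
  then show ?thesis unfolding geom_refl_def[of M i "geom_refl M i v"] by (simp add: geom_refl_def)
qed

section \<open>Letters occurring in a product of commuting reflections\<close>

abbreviation coxeter_cong :: "'a coxeter_matrix \<Rightarrow> ('a list \<times> 'a list) set" where
  "coxeter_cong M \<equiv> word_cong (index M) (coxeter_relations M)"

lemma geom_refl_coxeter_cong:
  assumes "is_coxeter_matrix M" "(u, v) \<in> coxeter_cong M"
  shows "foldr (geom_refl M) u = foldr (geom_refl M) v"
  using assms(2)
proof (rule word_cong_induct_invariant)
  fix u v p q assume "(u, v) \<in> coxeter_relations M"
  then obtain i j n where *: "i \<in> index M" "j \<in> index M" "entry M i j = enat n"
    "u = concat (replicate n [i, j])" "v = []"
    unfolding coxeter_relations_def by blast
  have id: "foldr (geom_refl M) u x = x" for x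
  proof (cases "i = j")
    case True
    then have "n = 1" using * assms(1) unfolding is_coxeter_matrix_def by (auto simp: one_enat_def)
    then show ?thesis using True * geom_refl_involution[OF assms(1)] by simp
  next
    case False
    then show ?thesis using geom_refl_relation_order[OF assms(1) *(1,2) _ *(3)] *(4) by simp
  qed
  show "foldr (geom_refl M) (p @ u @ q) = foldr (geom_refl M) (p @ v @ q)"
    by (rule ext) (simp add: id *(5))
qed

definition commuting_letters :: "'a coxeter_matrix \<Rightarrow> 'a list \<Rightarrow> bool" where
  "commuting_letters M w \<longleftrightarrow> distinct w \<and> set w \<subseteq> index M \<and>
     (\<forall>x\<in>set w. \<forall>y\<in>set w. x \<noteq> y \<longrightarrow> entry M x y = 2)"

text \<open>Entry 2 means orthogonal roots, so every letter other than \<open>x\<close> fixes the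
  root of \<open>x\<close>, while \<open>x\<close> itself negates it and occurs at most
  once.\<close>

lemma foldr_geom_refl_commuting:
  assumes "is_coxeter_matrix M" "x \<in> index M" "distinct w" "set w \<subseteq> index M"
    and "\<And>y. \<lbrakk>y \<in> set w; y \<noteq> x\<rbrakk> \<Longrightarrow> entry M y x = 2"
  shows "foldr (geom_refl M) w ((\<lambda>_. 0)(x := c)) = (\<lambda>_. 0)(x := if x \<in> set w then - c else c)"
  using assms(3-5)
proof (induction w)
  case (Cons y w)
  have fin: "finite (index M)" using assms(1) unfolding is_coxeter_matrix_def by blast
  have pair: "root_pairing M z ((\<lambda>_. 0)(x := d)) = cos_form M z x * d" for z d
    using fin assms(2) by (simp add: root_pairing_def if_distrib cong: if_cong)
  have "cos_form M x x = 1"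
    using assms(1,2) unfolding is_coxeter_matrix_def by (simp add: cos_form_def one_enat_def)
  then have same: "geom_refl M x ((\<lambda>_. 0)(x := d)) = (\<lambda>_. 0)(x := - d)" for d
    by (simp add: geom_refl_def pair)
  have other: "geom_refl M y ((\<lambda>_. 0)(x := d)) = (\<lambda>_. 0)(x := d)" if "y \<noteq> x" for d
  proof -
    have "cos_form M y x = 0" using Cons.prems(3)[of y] that by (simp add: cos_form_def numeral_eq_enat)
    then show ?thesis by (simp add: geom_refl_def pair fun_upd_idem)
  qed
  have IH: "foldr (geom_refl M) w ((\<lambda>_. 0)(x := c)) = (\<lambda>_. 0)(x := if x \<in> set w then - c else c)"
    by (rule Cons.IH) (use Cons.prems in auto)
  show ?case
  proof (cases "y = x")
    case True
    then show ?thesis using Cons.prems(1) by (simp only: foldr.simps o_apply IH same) simp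
  next
    case False
    then show ?thesis by (simp only: foldr.simps o_apply IH other[OF False]) simp
  qed
qed simp

lemma foldr_geom_refl_other: "x \<notin> set w \<Longrightarrow> foldr (geom_refl M) w v x = v x"
  by (induction w) (auto simp: geom_refl_def)

text \<open>On the root of \<open>x\<close> the word \<open>w\<close> gives the coordinate -1 at
  \<open>x\<close>; a word without the letter \<open>x\<close> would leave it at 1.\<close>

lemma commuting_letters_occur:
  assumes "is_coxeter_matrix M" "commuting_letters M w" "(w, u) \<in> coxeter_cong M"
  shows "set w \<subseteq> set u"
proof
  fix x assume x: "x \<in> set w"
  show "x \<in> set u"
  proof (rule ccontr)
    assume "x \<notin> set u"
    from foldr_geom_refl_other[OF this, of M "(\<lambda>_. 0)(x := 1)"]
    have "foldr (geom_refl M) w ((\<lambda>_. 0)(x := 1)) x = 1"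
      unfolding geom_refl_coxeter_cong[OF assms(1,3)] by simp
    moreover have "foldr (geom_refl M) w ((\<lambda>_. 0)(x := 1)) = (\<lambda>_. 0)(x := - 1)"
      using foldr_geom_refl_commuting[OF assms(1), of x w 1] assms(2) x
      unfolding commuting_letters_def by auto
    ultimately show False by simp
  qed
qed

section \<open>Parabolic subgroups generated by commuting reflections\<close>

lemma coxeter_square_cong:
  assumes "is_coxeter_matrix M" "i \<in> index M"
  shows "([i, i], []) \<in> coxeter_cong M"
proof -
  have "([i, i], []) \<in> coxeter_relations M"
    using assms unfolding coxeter_relations_def is_coxeter_matrix_def
    by (auto intro!: exI[of _ i] exI[of _ "1::nat"] simp: one_enat_def)
  from word_cong.rel[OF this, of "index M" "[]" "[]"] show ?thesis using assms by simp
qed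

text \<open>The word \<open>ijijji\<close> reduces to \<open>ji\<close> by the relation for the pair
  and to \<open>ij\<close> by cancelling squares.\<close>

lemma coxeter_commute_cong:
  assumes "is_coxeter_matrix M" "i \<in> index M" "j \<in> index M" "entry M i j = 2"
  shows "([i, j], [j, i]) \<in> coxeter_cong M"
proof -
  note ctx = word_cong_context[where I = "index M" and R = "coxeter_relations M"]
  have "concat (replicate 2 [i, j]) = [i, j, i, j]" by (simp add: numeral_2_eq_2)
  moreover have "entry M i j = enat 2" using assms(4) by (simp add: numeral_eq_enat)
  ultimately have "([i, j, i, j], []) \<in> coxeter_relations M"
    using assms(2,3) unfolding coxeter_relations_def by force
  from word_cong.rel[OF this, of "index M" "[]" "[j, i]"]
  have "([i, j, i, j, j, i], [j, i]) \<in> coxeter_cong M" using assms by simp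
  moreover have "([i, j, i, j, j, i], [i, j, i, i]) \<in> coxeter_cong M"
    using ctx[OF coxeter_square_cong[OF assms(1,3)], of "[i, j, i]" "[i]"] assms by simp
  moreover have "([i, j, i, i], [i, j]) \<in> coxeter_cong M"
    using ctx[OF coxeter_square_cong[OF assms(1,2)], of "[i, j]" "[]"] assms by simp
  ultimately show ?thesis by (blast intro: word_cong.sym word_cong.trans)
qed

text \<open>The new letter is moved to the right until it meets its occurrence in \<open>u\<close>,
  where the two cancel.\<close>

lemma commuting_cons_normal_form:
  assumes "is_coxeter_matrix M" "set u \<subseteq> index M" "x \<in> index M"
    and "\<And>y. \<lbrakk>y \<in> set u; y \<noteq> x\<rbrakk> \<Longrightarrow> entry M x y = 2" "x \<in> set u"
  shows "(x # u, remove1 x u) \<in> coxeter_cong M"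
  using assms(2,4,5)
proof (induction u)
  case (Cons y u)
  have u: "u \<in> lists (index M)" using Cons.prems(1) by auto
  note ctx = word_cong_context[where I = "index M" and R = "coxeter_relations M"]
  show ?case
  proof (cases "x = y")
    case True
    then show ?thesis using ctx[OF coxeter_square_cong[OF assms(1,3)], of "[]" u] u by simp
  next
    case False
    have y: "y \<in> index M" using Cons.prems(1) by simp
    have "(x # u, remove1 x u) \<in> coxeter_cong M" using Cons False by auto
    from ctx[OF this, of "[y]" "[]"] have "(y # x # u, y # remove1 x u) \<in> coxeter_cong M"
      using y by simp
    moreover have "entry M x y = 2" using Cons.prems(2) False by simp
    from ctx[OF coxeter_commute_cong[OF assms(1,3) y this], of "[]" u]
    have "(x # y # u, y # x # u) \<in> coxeter_cong M" using u by simp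
    ultimately show ?thesis using False by (auto intro: word_cong.trans)
  qed
qed simp

lemma commuting_normal_form:
  assumes "is_coxeter_matrix M" "commuting_letters M w" "u \<in> lists (set w)"
  shows "\<exists>v. distinct v \<and> set v \<subseteq> set w \<and> (u, v) \<in> coxeter_cong M"
  using assms(3)
proof (induction u rule: lists.induct)
  case Nil
  show ?case by (intro exI[of _ "[]"]) (simp add: word_cong.refl)
next
  case (Cons x u)
  then obtain v where v: "distinct v" "set v \<subseteq> set w" "(u, v) \<in> coxeter_cong M" by blast
  have w: "set w \<subseteq> index M" "\<And>x y. \<lbrakk>x \<in> set w; y \<in> set w; x \<noteq> y\<rbrakk> \<Longrightarrow> entry M x y = 2"
    using assms(2) unfolding commuting_letters_def by auto
  have "(x # u, x # v) \<in> coxeter_cong M"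
    using word_cong_context[OF v(3), of "[x]" "[]"] Cons(1) w(1) by auto
  moreover have "(x # v, remove1 x v) \<in> coxeter_cong M" if "x \<in> set v"
    using commuting_cons_normal_form[OF assms(1), of v x] that v(2) w Cons(1) by blast
  ultimately have "(x # u, if x \<in> set v then remove1 x v else x # v) \<in> coxeter_cong M"
    by (auto intro: word_cong.trans)
  moreover have "set (remove1 x v) \<subseteq> set w" using set_remove1_subset[of x v] v(2) by blast
  ultimately show ?case
    using v(1,2) Cons(1)
    by (intro exI[of _ "if x \<in> set v then remove1 x v else x # v"]) simp
qed

text \<open>\<open>generate\<close> also admits inverses of generators, but these are the generators
  themselves.\<close>

lemma parabolic_subgroup_words:
  assumes "is_coxeter_matrix M" "J \<subseteq> index M"
  shows "parabolic_subgroup M J = word_class (index M) (coxeter_relations M) ` lists J"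
proof -
  let ?W = "word_class (index M) (coxeter_relations M)" and ?G = "coxeter_group M"
  interpret group ?G by (rule group_coxeter_group[OF assms(1)])
  have mult: "?W u \<otimes>\<^bsub>?G\<^esub> ?W v = ?W (u @ v)" if "u \<in> lists J" "v \<in> lists J" for u v
    unfolding coxeter_group_def using that assms(2) lists_mono[OF assms(2)]
    by (intro word_class_mult) auto
  have one: "\<one>\<^bsub>?G\<^esub> = ?W []" unfolding coxeter_group_def by (rule one_presented)
  have inv: "inv\<^bsub>?G\<^esub> ?W [h] = ?W [h]" if "h \<in> J" for h
  proof (rule inv_equality)
    have h: "h \<in> index M" using that assms(2) by blast
    have "?W [h, h] = ?W []"
      using word_class_eq_iff[of "[h, h]" "index M" "[]"] coxeter_square_cong[OF assms(1) h] h by simp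
    then show "?W [h] \<otimes>\<^bsub>?G\<^esub> ?W [h] = \<one>\<^bsub>?G\<^esub>" using mult[of "[h]" "[h]"] that one by simp
    show "?W [h] \<in> carrier ?G" "?W [h] \<in> carrier ?G"
      unfolding coxeter_group_def using h by (auto intro: word_class_carrier)
  qed
  have "x \<in> ?W ` lists J" if "x \<in> parabolic_subgroup M J" for x
    using that unfolding parabolic_subgroup_def
  proof (induction rule: generate.induct)
    case one
    then show ?case unfolding \<open>\<one>\<^bsub>?G\<^esub> = ?W []\<close> by blast
  next
    case (incl h)
    then show ?case unfolding coxeter_gen_def by auto
  next
    case (inv h)
    then obtain y where "y \<in> J" "h = ?W [y]" unfolding coxeter_gen_def by auto
    then show ?case using \<open>\<And>h. h \<in> J \<Longrightarrow> inv\<^bsub>?G\<^esub> ?W [h] = ?W [h]\<close> by auto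
  next
    case (eng h1 h2)
    then obtain u v where "u \<in> lists J" "v \<in> lists J" "h1 = ?W u" "h2 = ?W v" by blast
    then show ?case using mult[of u v] by auto
  qed
  moreover have "?W u \<in> parabolic_subgroup M J" if "u \<in> lists J" for u
    using that
  proof (induction u rule: lists.induct)
    case Nil
    show ?case unfolding parabolic_subgroup_def one[symmetric] by (rule generate.one)
  next
    case (Cons x u)
    have "?W [x] \<otimes>\<^bsub>?G\<^esub> ?W u \<in> parabolic_subgroup M J"
      using Cons unfolding parabolic_subgroup_def coxeter_gen_def
      by (intro generate.eng[OF generate.incl]) auto
    then show ?case using mult[of "[x]" u] Cons by simp
  qed
  ultimately show ?thesis by blast
qed

lemma coxeter_length_word_class_le:
  "u \<in> lists (index M) \<Longrightarrow> coxeter_length (word_class (index M) (coxeter_relations M) u) \<le> length u"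
  unfolding coxeter_length_def
  by (rule Least_le) (auto simp: word_class_def intro: word_cong.refl)

text \<open>The normal forms are distinct lists over \<open>set w\<close>: there are finitely many,
  none longer than \<open>w\<close>. Conversely every word for the element of \<open>w\<close>
  contains all letters of \<open>w\<close>, so \<open>w\<close> is reduced.\<close>

lemma commuting_letters_longest:
  assumes "is_coxeter_matrix M" "commuting_letters M w"
  defines "W \<equiv> word_class (index M) (coxeter_relations M)"
  shows "finite (parabolic_subgroup M (set w))"
    and "is_longest_element M (set w) (W w)"
    and "reduced_expression w (W w)"
proof -
  have w: "set w \<subseteq> index M" "distinct w" "w \<in> lists (index M)"
    using assms(2) unfolding commuting_letters_def by auto
  have sub: "\<exists>v. distinct v \<and> set v \<subseteq> set w \<and> x = W v" if x: "x \<in> parabolic_subgroup M (set w)" for x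
  proof -
    obtain u where u: "u \<in> lists (set w)" "x = W u"
      using x unfolding parabolic_subgroup_words[OF assms(1) w(1)] W_def by blast
    obtain v where "distinct v" "set v \<subseteq> set w" "(u, v) \<in> coxeter_cong M"
      using commuting_normal_form[OF assms(1,2) u(1)] by blast
    then show ?thesis
      using u(2) word_class_eq_iff[of u "index M" v] word_cong_lists unfolding W_def by blast
  qed
  have "parabolic_subgroup M (set w) \<subseteq> W ` {v. set v \<subseteq> set w \<and> distinct v}"
    using sub by blast
  then show "finite (parabolic_subgroup M (set w))"
    by (rule finite_subset) (simp add: finite_subset_distinct)
  have least: "length w \<le> length u" if "u \<in> W w" for u
  proof -
    have "set w \<subseteq> set u"
      using commuting_letters_occur[OF assms(1,2)] that by (simp add: W_def word_class_def)
    then have "card (set w) \<le> card (set u)" by (simp add: card_mono)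
    then show ?thesis using distinct_card[OF w(2)] card_length[of u] by simp
  qed
  have mem: "w \<in> W w" using w(3) by (simp add: W_def word_class_def word_cong.refl)
  have len: "coxeter_length (W w) = length w"
    unfolding coxeter_length_def using least mem by (intro Least_equality) auto
  then show "reduced_expression w (W w)" using mem by (simp add: reduced_expression_def)
  show "is_longest_element M (set w) (W w)"
    unfolding is_longest_element_def
  proof (intro conjI ballI)
    show "W w \<in> parabolic_subgroup M (set w)"
      unfolding parabolic_subgroup_words[OF assms(1) w(1)] W_def by blast
    fix x assume "x \<in> parabolic_subgroup M (set w)"
    then obtain v where v: "distinct v" "set v \<subseteq> set w" "x = W v" using sub by blast
    have "coxeter_length x \<le> length v"
      unfolding v(3) W_def using v(2) w(1) by (intro coxeter_length_word_class_le) auto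
    also have "\<dots> \<le> length w"
      using card_mono[OF _ v(2)] distinct_card[OF v(1)] distinct_card[OF w(2)] by simp
    finally show "coxeter_length x \<le> coxeter_length (W w)" using len by simp
  qed
qed

lemma standard_of_commuting_letters:
  assumes "artin_hom A B \<phi>"
    and "\<And>i. i \<in> index A \<Longrightarrow> \<exists>w. commuting_letters B w \<and> \<phi> (artin_gen A i) = artin_word B w"
  shows "standard A B \<phi>"
proof -
  have B: "is_coxeter_matrix B" using assms(1) unfolding artin_hom_def by blast
  show ?thesis
    unfolding standard_def
  proof (intro conjI ballI assms(1))
    fix i assume "i \<in> index A"
    then obtain w where w: "commuting_letters B w" "\<phi> (artin_gen A i) = artin_word B w"
      using assms(2) by blast
    then have "set w \<subseteq> index B" unfolding commuting_letters_def by blast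
    then show "\<exists>J\<subseteq>index B. finite (parabolic_subgroup B J) \<and>
        (\<exists>w ws. is_longest_element B J w \<and> reduced_expression ws w \<and>
           \<phi> (artin_gen A i) = artin_word B ws)"
      using commuting_letters_longest[OF B w(1)] w(2) by blast
  qed
qed

section \<open>Tits homomorphisms as foldings\<close>

lemma word_cong_step:
  "\<lbrakk>(u, v) \<in> word_cong I R; s = p @ u @ q; t = p @ v @ q; p \<in> lists I; q \<in> lists I\<rbrakk>
    \<Longrightarrow> (s, t) \<in> word_cong I R"
  using word_cong_context by blast

lemma word_cong_commute_letter:
  assumes "x \<in> I" "v \<in> lists I" "\<And>y. y \<in> set v \<Longrightarrow> ([x, y], [y, x]) \<in> word_cong I R"
  shows "(x # v, v @ [x]) \<in> word_cong I R"
  using assms(2,3)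
proof (induction v rule: lists.induct)
  case Nil
  show ?case using assms(1) by (simp add: word_cong.refl)
next
  case (Cons y v)
  have "(x # y # v, y # x # v) \<in> word_cong I R"
    by (rule word_cong_step[OF Cons.prems, of y _ "[]" v]) (use Cons in auto)
  moreover have "(y # x # v, y # v @ [x]) \<in> word_cong I R"
    by (rule word_cong_step[OF Cons.IH, of _ "[y]" "[]"]) (use Cons in auto)
  ultimately show ?case by (auto intro: word_cong.trans)
qed

lemma word_cong_commute:
  assumes "u \<in> lists I" "v \<in> lists I"
    and "\<And>x y. \<lbrakk>x \<in> set u; y \<in> set v\<rbrakk> \<Longrightarrow> ([x, y], [y, x]) \<in> word_cong I R"
  shows "(u @ v, v @ u) \<in> word_cong I R"
  using assms(1,3)
proof (induction u rule: lists.induct)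
  case Nil
  show ?case using assms(2) by (simp add: word_cong.refl)
next
  case (Cons x u)
  have "(x # u @ v, x # v @ u) \<in> word_cong I R"
    by (rule word_cong_step[OF Cons.IH, of _ "[x]" "[]"]) (use Cons in auto)
  moreover have "(x # v @ u, v @ x # u) \<in> word_cong I R"
    by (rule word_cong_step[OF word_cong_commute_letter, of x I v R _ "[]" u]) (use Cons assms(2) in auto)
  ultimately show ?case by (auto intro: word_cong.trans)
qed

text \<open>In type \<open>A\<^sub>3\<close> with middle node \<open>b\<close>, the elements \<open>xy\<close> and \<open>b\<close> satisfy the braid relation of
  length 4; in type \<open>D\<^sub>4\<close> with central node \<open>b\<close>, the elements \<open>xyz\<close> and \<open>b\<close> satisfy the one of
  length 6.\<close>

lemma word_cong_A3:
  assumes "{x, y, b} \<subseteq> I" "([x, y], [y, x]) \<in> word_cong I R"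
    and "([x, b, x], [b, x, b]) \<in> word_cong I R" "([y, b, y], [b, y, b]) \<in> word_cong I R"
  shows "([x, y, b, x, y, b], [b, x, y, b, x, y]) \<in> word_cong I R"
proof -
  define sim (infix "\<sim>" 50) where "u \<sim> v \<longleftrightarrow> (u, v) \<in> word_cong I R" for u v
  have [trans]: "u \<sim> w" if "u \<sim> v" "v \<sim> w" for u v w
    using that unfolding sim_def by (rule word_cong.trans)
  have step: "p @ u @ q \<sim> p @ v @ q" if "u \<sim> v" "set p \<subseteq> I" "set q \<subseteq> I" for p q u v
    using that word_cong_context[of u v I R p q] unfolding sim_def by (simp add: in_lists_conv_set subset_eq)
  have sym: "v \<sim> u" if "u \<sim> v" for u v using that unfolding sim_def by (rule word_cong.sym)
  have xy: "[x, y] \<sim> [y, x]" and xb: "[x, b, x] \<sim> [b, x, b]" and yb: "[y, b, y] \<sim> [b, y, b]"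
    using assms(2-4) unfolding sim_def .
  note I = assms(1)
  have "[x, y, b, x, y, b] \<sim> [y, x, b, x, y, b]" using step[OF xy, of "[]" "[b, x, y, b]"] I by simp
  also have "\<dots> \<sim> [y, b, x, b, y, b]" using step[OF xb, of "[y]" "[y, b]"] I by simp
  also have "\<dots> \<sim> [y, b, x, y, b, y]" using step[OF sym[OF yb], of "[y, b, x]" "[]"] I by simp
  also have "\<dots> \<sim> [y, b, y, x, b, y]" using step[OF xy, of "[y, b]" "[b, y]"] I by simp
  also have "\<dots> \<sim> [b, y, b, x, b, y]" using step[OF yb, of "[]" "[x, b, y]"] I by simp
  also have "\<dots> \<sim> [b, y, x, b, x, y]" using step[OF sym[OF xb], of "[b, y]" "[y]"] I by simp
  also have "\<dots> \<sim> [b, x, y, b, x, y]" using step[OF sym[OF xy], of "[b]" "[b, x, y]"] I by simp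
  finally show ?thesis unfolding sim_def .
qed

lemma word_cong_D4:
  assumes "{x, y, z, b} \<subseteq> I"
    and "([x, y], [y, x]) \<in> word_cong I R" "([x, z], [z, x]) \<in> word_cong I R"
    and "([y, z], [z, y]) \<in> word_cong I R"
    and "([x, b, x], [b, x, b]) \<in> word_cong I R" "([y, b, y], [b, y, b]) \<in> word_cong I R"
    and "([z, b, z], [b, z, b]) \<in> word_cong I R"
  shows "([x, y, z, b, x, y, z, b, x, y, z, b], [b, x, y, z, b, x, y, z, b, x, y, z]) \<in> word_cong I R"
proof -
  define sim (infix "\<sim>" 50) where "u \<sim> v \<longleftrightarrow> (u, v) \<in> word_cong I R" for u v
  have [trans]: "u \<sim> w" if "u \<sim> v" "v \<sim> w" for u v w
    using that unfolding sim_def by (rule word_cong.trans)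
  have step: "p @ u @ q \<sim> p @ v @ q" if "u \<sim> v" "set p \<subseteq> I" "set q \<subseteq> I" for p q u v
    using that word_cong_context[of u v I R p q] unfolding sim_def by (simp add: in_lists_conv_set subset_eq)
  have sym: "v \<sim> u" if "u \<sim> v" for u v using that unfolding sim_def by (rule word_cong.sym)
  note I = assms(1)
  have rot: "[x, y, z] \<sim> [y, z, x]"
    unfolding sim_def using word_cong_commute_letter[of x I "[y, z]" R] assms(1-3) by auto
  have xb: "[x, b, x] \<sim> [b, x, b]" using assms(5) unfolding sim_def .
  \<comment> \<open>The nodes \<open>y\<close>, \<open>z\<close> and \<open>b\<close> form a diagram
    of type \<open>A_3\<close>. Together with \<open>rot\<close> and the relation between
    \<open>x\<close> and \<open>b\<close> this is all that the computation uses.\<close>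
  have yzb: "[y, z, b, y, z, b] \<sim> [b, y, z, b, y, z]"
    unfolding sim_def using word_cong_A3[of y z b I R] assms by simp
  have "[x, y, z, b, x, y, z, b, x, y, z, b] \<sim> [x, y, z, b, y, z, x, b, x, y, z, b]"
    using step[OF rot, of "[x, y, z, b]" "[b, x, y, z, b]"] I by simp
  also have "\<dots> \<sim> [x, y, z, b, y, z, b, x, b, y, z, b]"
    using step[OF xb, of "[x, y, z, b, y, z]" "[y, z, b]"] I by simp
  also have "\<dots> \<sim> [x, b, y, z, b, y, z, x, b, y, z, b]"
    using step[OF yzb, of "[x]" "[x, b, y, z, b]"] I by simp
  also have "\<dots> \<sim> [x, b, y, z, b, x, y, z, b, y, z, b]"
    using step[OF sym[OF rot], of "[x, b, y, z, b]" "[b, y, z, b]"] I by simp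
  also have "\<dots> \<sim> [x, b, y, z, b, x, b, y, z, b, y, z]"
    using step[OF yzb, of "[x, b, y, z, b, x]" "[]"] I by simp
  also have "\<dots> \<sim> [x, b, y, z, x, b, x, y, z, b, y, z]"
    using step[OF sym[OF xb], of "[x, b, y, z]" "[y, z, b, y, z]"] I by simp
  also have "\<dots> \<sim> [x, b, y, z, x, b, y, z, x, b, y, z]"
    using step[OF rot, of "[x, b, y, z, x, b]" "[b, y, z]"] I by simp
  also have "\<dots> \<sim> [x, b, x, y, z, b, y, z, x, b, y, z]"
    using step[OF sym[OF rot], of "[x, b]" "[b, y, z, x, b, y, z]"] I by simp
  also have "\<dots> \<sim> [b, x, b, y, z, b, y, z, x, b, y, z]"
    using step[OF xb, of "[]" "[y, z, b, y, z, x, b, y, z]"] I by simp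
  also have "\<dots> \<sim> [b, x, y, z, b, y, z, b, x, b, y, z]"
    using step[OF sym[OF yzb], of "[b, x]" "[x, b, y, z]"] I by simp
  also have "\<dots> \<sim> [b, x, y, z, b, y, z, x, b, x, y, z]"
    using step[OF sym[OF xb], of "[b, x, y, z, b, y, z]" "[y, z]"] I by simp
  also have "\<dots> \<sim> [b, x, y, z, b, x, y, z, b, x, y, z]"
    using step[OF sym[OF rot], of "[b, x, y, z, b]" "[b, x, y, z]"] I by simp
  finally show ?thesis unfolding sim_def .
qed

text \<open>Nodes in one fibre of \<open>f\<close> commute and nodes in different fibres inherit
  their entry from \<open>B\<close>, which is exactly what makes \<open>f\<close> compatible with
  folding.\<close>

definition unfold_matrix :: "'a coxeter_matrix \<Rightarrow> ('b \<Rightarrow> 'a) \<Rightarrow> 'b set \<Rightarrow> 'b coxeter_matrix" where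
  "unfold_matrix B f P = \<lparr>index = P,
     entry = (\<lambda>x y. if x = y then 1 else if f x = f y then 2 else entry B (f x) (f y))\<rparr>"

lemma unfold_matrix_simps [simp]:
  "index (unfold_matrix B f P) = P"
  "entry (unfold_matrix B f P) x y =
    (if x = y then 1 else if f x = f y then 2 else entry B (f x) (f y))"
  by (simp_all add: unfold_matrix_def)

lemma is_coxeter_unfold_matrix:
  assumes "is_coxeter_matrix B" "finite P" "f ` P \<subseteq> index B"
  shows "is_coxeter_matrix (unfold_matrix B f P)"
  unfolding is_coxeter_matrix_def
proof (intro conjI ballI impI)
  fix x y assume "x \<in> index (unfold_matrix B f P)" "y \<in> index (unfold_matrix B f P)"
  then have xy: "f x \<in> index B" "f y \<in> index B" using assms(3) by auto
  show "entry (unfold_matrix B f P) x y = entry (unfold_matrix B f P) y x"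
    using coxeter_entry_commute[OF assms(1) xy] by simp
  assume "x \<noteq> y"
  then show "2 \<le> entry (unfold_matrix B f P) x y"
    using assms(1) xy unfolding is_coxeter_matrix_def by simp
qed (use assms(2) in simp_all)

lemma braid_hom_unfold_fold:
  assumes "is_coxeter_matrix B" "finite P" "f ` P \<subseteq> index B"
  shows "braid_hom (unfold_matrix B f P) B (\<lambda>x. [f x])"
  using assms by (intro braid_hom_letter is_coxeter_unfold_matrix) auto

text \<open>The word \<open>w i\<close> lists the \<open>d i\<close> commuting nodes over
  \<open>i\<close>. A finite Tits entry off the diagonal leaves three cases: commuting blocks, two
  single letters, or entry 3 with one block of length 1 and the other of length 2 or 3. The last
  case is the relation of type \<open>A_3\<close> or \<open>D_4\<close>.\<close>

lemma braid_hom_tits_unfold: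
  assumes "is_coxeter_matrix A" "is_coxeter_matrix B" "index A = index B"
    and entry: "\<And>i j. \<lbrakk>i \<in> index B; j \<in> index B\<rbrakk> \<Longrightarrow> entry A i j = tits_entry (entry B i j) (d i) (d j)"
    and block: "\<And>i. i \<in> index B \<Longrightarrow> length (w i) = d i \<and> distinct (w i) \<and> (\<forall>x\<in>set (w i). f x = i)"
  shows "braid_hom A (unfold_matrix B f (\<Union>i\<in>index B. set (w i))) w"
proof (rule braid_homI)
  let ?P = "\<Union>i\<in>index B. set (w i)"
  let ?U = "unfold_matrix B f ?P"
  have fin: "finite (index B)" using assms(2) unfolding is_coxeter_matrix_def by blast
  show "is_coxeter_matrix A" by (rule assms(1))
  show U: "is_coxeter_matrix ?U"
    using block by (intro is_coxeter_unfold_matrix assms(2)) (auto simp: fin)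
  show "w i \<in> lists (index ?U)" if "i \<in> index A" for i using that assms(3) by auto
  have rel: "(alt_word n x y, alt_word n y x) \<in> braid_cong ?U"
    if "i \<in> index B" "j \<in> index B" "i \<noteq> j" "entry B i j = enat n" "x \<in> set (w i)" "y \<in> set (w j)"
    for i j n x y
    using that block[OF that(1)] block[OF that(2)] by (intro braid_relation_cong) auto
  have comm: "([x, y], [y, x]) \<in> braid_cong ?U"
    if "i \<in> index B" "x \<in> set (w i)" "y \<in> set (w i)" "x \<noteq> y" for i x y
    using braid_relation_cong[of x ?U y 2] that block[OF that(1)]
    by (auto simp: numeral_2_eq_2 numeral_eq_enat)
  have thick: "(concat (alt_word n (w i) (w j)), concat (alt_word n (w j) (w i))) \<in> braid_cong ?U"
    if ij: "i \<in> index B" "j \<in> index B" "i \<noteq> j" "entry B i j = 3"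
      and d: "d i \<in> {2, 3}" "d j = 1" "n = 2 * d i" for i j n
  proof -
    have three: "3 = Suc (Suc (Suc 0))" by simp
    obtain b where b: "w j = [b]"
      using block[OF ij(2)] d(2) by (metis One_nat_def length_0_conv length_Suc_conv)
    have e: "entry B i j = enat 3" using ij(4) by (simp add: numeral_eq_enat)
    have xb: "([x, b, x], [b, x, b]) \<in> braid_cong ?U" if "x \<in> set (w i)" for x
      using rel[OF ij(1-3) e that, of b] b by (simp add: three)
    have P: "set (w i) \<union> set (w j) \<subseteq> ?P" using ij by blast
    from d(1) show ?thesis
    proof (elim insertE emptyE)
      assume "d i = 2"
      then obtain x y where xy: "w i = [x, y]"
        using block[OF ij(1)] by (auto simp: numeral_2_eq_2 length_Suc_conv)
      have "x \<noteq> y" using block[OF ij(1)] xy by auto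
      then have "([x, y, b, x, y, b], [b, x, y, b, x, y]) \<in> braid_cong ?U"
        using P xy b xb comm[OF ij(1), of x y] by (intro word_cong_A3) auto
      then show ?thesis using \<open>d i = 2\<close> d(3) by (simp add: xy b numeral_eq_Suc)
    next
      assume "d i = 3"
      then obtain x y z where xyz: "w i = [x, y, z]"
        using block[OF ij(1)] by (auto simp: numeral_3_eq_3 length_Suc_conv)
      have "distinct [x, y, z]" using block[OF ij(1)] xyz by auto
      then have "([x, y, z, b, x, y, z, b, x, y, z, b], [b, x, y, z, b, x, y, z, b, x, y, z]) \<in> braid_cong ?U"
        using P xyz b xb comm[OF ij(1), of x y] comm[OF ij(1), of x z] comm[OF ij(1), of y z]
        by (intro word_cong_D4) auto
      then show ?thesis using \<open>d i = 3\<close> d(3) by (simp add: xyz b numeral_eq_Suc)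
    qed
  qed
  fix i j n assume "i \<in> index A" "j \<in> index A" and ne: "i \<noteq> j" and n: "entry A i j = enat n"
  then have ij: "i \<in> index B" "j \<in> index B" using assms(3) by auto
  have tits: "tits_entry (entry B i j) (d i) (d j) = enat n" using entry[OF ij] n by simp
  have ge2: "2 \<le> entry B i j" using assms(2) ij ne unfolding is_coxeter_matrix_def by blast
  have sym: "entry B j i = entry B i j" by (rule coxeter_entry_commute[OF assms(2) ij(2,1)])
  consider "entry B i j = 2" | "d i * d j = 1" "entry B i j = enat n"
    | "entry B i j = 3" "d i * d j \<in> {2, 3}" "n = 2 * d i * d j"
    using tits ge2 unfolding tits_entry_def by (auto split: if_splits)
  then have "(concat (alt_word n (w i) (w j)), concat (alt_word n (w j) (w i))) \<in> braid_cong ?U"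
  proof cases
    case 1
    then have "n = 2" using tits by (simp add: tits_entry_def numeral_eq_enat)
    moreover have "([x, y], [y, x]) \<in> braid_cong ?U" if "x \<in> set (w i)" "y \<in> set (w j)" for x y
      using rel[OF ij ne _ that, of 2] 1 by (simp add: numeral_eq_enat numeral_2_eq_2)
    then have "(w i @ w j, w j @ w i) \<in> braid_cong ?U"
      using ij by (intro word_cong_commute) auto
    ultimately show ?thesis by (simp add: numeral_2_eq_2)
  next
    case 2
    then obtain x y where xy: "w i = [x]" "w j = [y]"
      using block[OF ij(1)] block[OF ij(2)] by (auto simp: length_Suc_conv)
    have single: "concat (alt_word n [x] [y]) = alt_word n x y" for x y :: 'b
      by (induction n arbitrary: x y) auto
    show ?thesis using rel[OF ij ne 2(2), of x y] by (simp add: xy single)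
  next
    case 3
    \<comment> \<open>The product is prime, so one of the factors is 1.\<close>
    have "d i = 1 \<and> d j \<in> {2, 3} \<or> d j = 1 \<and> d i \<in> {2, 3}"
      using 3(2) prime_product[of "d i" "d j"] by auto
    then show ?thesis
    proof
      assume "d j = 1 \<and> d i \<in> {2, 3}"
      then show ?thesis using thick[OF ij ne 3(1)] 3(3) by simp
    next
      assume "d i = 1 \<and> d j \<in> {2, 3}"
      then show ?thesis using thick[OF ij(2,1) _ _ ] ne 3(1,3) sym by (auto intro: word_cong.sym)
    qed
  qed
  then show "(word_subst w (alt_word n i j), word_subst w (alt_word n j i)) \<in> braid_cong ?U"
    by (simp add: map_alt_word)
qed

lemma braid_hom_eq:
  assumes "braid_hom A B g" "\<And>i. i \<in> index A \<Longrightarrow> g i = h i"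
  shows "braid_hom A B h"
proof (rule braid_homI)
  have sub: "word_subst h w = word_subst g w" if "w \<in> lists (index A)" for w
    using that assms(2) by (intro word_subst_cong[of w "index A"]) auto
  fix i j n assume *: "i \<in> index A" "j \<in> index A" "i \<noteq> j" "entry A i j = enat n"
  have "(word_subst g (alt_word n i j), word_subst g (alt_word n j i)) \<in> braid_cong B"
    by (rule braid_hom_cong[OF assms(1) braid_relation_cong[OF *]])
  then show "(word_subst h (alt_word n i j), word_subst h (alt_word n j i)) \<in> braid_cong B"
    using sub[of "alt_word n i j"] sub[of "alt_word n j i"] * by (simp only: alt_word_in_lists)
qed (use assms in \<open>auto simp: braid_hom_def\<close>)

lemma map_eq_replicate: "\<forall>x\<in>set w. f x = i \<Longrightarrow> map f w = replicate (length w) i"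
  by (induction w) auto

text \<open>\<open>composition_of\<close> keeps all matrices over one type, so the nodes
  \<open>(i, k)\<close> of the unfolded diagram are embedded into it; infinity of the type leaves
  room, and \<open>f\<close> recovers the first component.\<close>

lemma exists_disjoint_blocks:
  fixes d :: "'b \<Rightarrow> nat"
  assumes "finite I"
  shows "\<exists>(w :: 'b \<Rightarrow> 'a::infinite list) f.
    \<forall>i\<in>I. length (w i) = d i \<and> distinct (w i) \<and> (\<forall>x\<in>set (w i). f x = i)"
proof -
  let ?S = "SIGMA i:I. {..<d i}"
  have "finite ?S" using assms by simp
  then obtain e :: "'b \<times> nat \<Rightarrow> 'a" where e: "inj_on e ?S"
    using arb_inj_on_finite_infinite by blast
  define w where "w i = map (\<lambda>k. e (i, k)) [0..<d i]" for i
  define f where "f x = fst (inv_into ?S e x)" for x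
  have "length (w i) = d i \<and> distinct (w i) \<and> (\<forall>x\<in>set (w i). f x = i)" if "i \<in> I" for i
    using that e inv_into_f_f[OF e, of "(i, _)"]
    by (auto simp: w_def f_def distinct_map inj_on_def)
  then show ?thesis by blast
qed

text \<open>That a Tits homomorphism respects the braid relations follows from its factorisation
  through the unfolded matrix.\<close>

lemma braid_hom_tits:
  fixes A B :: "'a::infinite coxeter_matrix"
  assumes "is_coxeter_matrix A" "is_coxeter_matrix B" "index A = index B"
    and "\<And>i j. \<lbrakk>i \<in> index B; j \<in> index B\<rbrakk> \<Longrightarrow> entry A i j = tits_entry (entry B i j) (d i) (d j)"
  shows "braid_hom A B (\<lambda>i. replicate (d i) i)"
proof -
  have fin: "finite (index B)" using assms(2) unfolding is_coxeter_matrix_def by blast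
  obtain w :: "'a \<Rightarrow> 'a list" and f
    where block: "\<forall>i\<in>index B. length (w i) = d i \<and> distinct (w i) \<and> (\<forall>x\<in>set (w i). f x = i)"
    using exists_disjoint_blocks[OF fin] by blast
  have "braid_hom A (unfold_matrix B f (\<Union>i\<in>index B. set (w i))) w"
    using block assms by (intro braid_hom_tits_unfold) auto
  moreover have "braid_hom (unfold_matrix B f (\<Union>i\<in>index B. set (w i))) B (\<lambda>x. [f x])"
    using fin block by (intro braid_hom_unfold_fold assms(2)) auto
  ultimately have "braid_hom A B (\<lambda>i. word_subst (\<lambda>x. [f x]) (w i))" by (rule braid_hom_comp)
  then show ?thesis
  proof (rule braid_hom_eq)
    fix i assume "i \<in> index A"
    then show "word_subst (\<lambda>x. [f x]) (w i) = replicate (d i) i"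
      using block assms(3) map_eq_replicate[of "w i" f i] by simp
  qed
qed

section \<open>Elementary homomorphisms as compositions of standard ones\<close>

lemma standard_of_generator_map:
  assumes "artin_hom A B \<phi>"
    and "\<And>i. i \<in> index A \<Longrightarrow> (\<exists>j\<in>index B. \<phi> (artin_gen A i) = artin_gen B j) \<or>
      \<phi> (artin_gen A i) = \<one>\<^bsub>artin_monoid B\<^esub>"
  shows "standard A B \<phi>"
proof (rule standard_of_commuting_letters[OF assms(1)])
  fix i assume "i \<in> index A"
  from assms(2)[OF this] show "\<exists>w. commuting_letters B w \<and> \<phi> (artin_gen A i) = artin_word B w"
  proof
    assume "\<exists>j\<in>index B. \<phi> (artin_gen A i) = artin_gen B j"
    then obtain j where "j \<in> index B" "\<phi> (artin_gen A i) = artin_gen B j" by blast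
    then show ?thesis
      by (intro exI[of _ "[j]"]) (simp add: commuting_letters_def artin_gen_def)
  next
    assume "\<phi> (artin_gen A i) = \<one>\<^bsub>artin_monoid B\<^esub>"
    then show ?thesis
      by (intro exI[of _ "[]"]) (simp add: commuting_letters_def one_artin)
  qed
qed

lemma tits_hom_composition_of_standard:
  fixes A B :: "'a::infinite coxeter_matrix"
  assumes "tits_hom A B \<phi>"
  shows "composition_of standard A B \<phi>"
proof -
  from assms obtain d where hom: "artin_hom A B \<phi>" and idx: "index A = index B"
    and entry: "\<And>i j. \<lbrakk>i \<in> index B; j \<in> index B\<rbrakk> \<Longrightarrow> entry A i j = tits_entry (entry B i j) (d i) (d j)"
    and gen: "\<And>i. i \<in> index A \<Longrightarrow> \<phi> (artin_gen A i) = artin_gen B i [^]\<^bsub>artin_monoid B\<^esub> (d i :: nat)"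
    unfolding tits_hom_def by blast
  have A: "is_coxeter_matrix A" and B: "is_coxeter_matrix B" using hom unfolding artin_hom_def by auto
  have fin: "finite (index B)" using B unfolding is_coxeter_matrix_def by blast
  obtain w :: "'a \<Rightarrow> 'a list" and f
    where block: "\<forall>i\<in>index B. length (w i) = d i \<and> distinct (w i) \<and> (\<forall>x\<in>set (w i). f x = i)"
    using exists_disjoint_blocks[OF fin] by blast
  define P where "P = (\<Union>i\<in>index B. set (w i))"
  let ?U = "unfold_matrix B f P"
  have P: "finite P" "f ` P \<subseteq> index B" using fin block by (auto simp: P_def)
  have unfold: "braid_hom A ?U w"
    unfolding P_def using block entry by (intro braid_hom_tits_unfold A B idx) auto
  have fold: "braid_hom ?U B (\<lambda>x. [f x])" by (rule braid_hom_unfold_fold[OF B P])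
  have "commuting_letters ?U (w i)" if "i \<in> index B" for i
    using block that by (auto simp: commuting_letters_def P_def)
  then have std1: "standard A ?U (induced_hom ?U w)"
    using idx by (intro standard_of_commuting_letters artin_hom_induced unfold)
      (auto simp: induced_hom_gen[OF unfold])
  have std2: "standard ?U B (induced_hom B (\<lambda>x. [f x]))"
  proof (rule standard_of_generator_map[OF artin_hom_induced[OF fold]], rule disjI1)
    fix x assume "x \<in> index ?U"
    then have "induced_hom B (\<lambda>x. [f x]) (artin_gen ?U x) = artin_gen B (f x)"
      by (rule induced_hom_letter[OF fold])
    moreover have "f x \<in> index B" using \<open>x \<in> index ?U\<close> P(2) by auto
    ultimately show "\<exists>j\<in>index B. induced_hom B (\<lambda>x. [f x]) (artin_gen ?U x) = artin_gen B j" by blast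
  qed
  have word: "word_subst (\<lambda>x. [f x]) (w i) = replicate (d i) i" if "i \<in> index A" for i
    using block that idx map_eq_replicate[of "w i" f i] by simp
  have "composition_of standard A ?U (induced_hom ?U w)"
    by (rule composition_of.single[where K = standard], rule std1) simp
  then have "composition_of standard A B (induced_hom B (\<lambda>i. word_subst (\<lambda>x. [f x]) (w i)))"
    using std2 unfold fold by (rule composition_of_induced_step)
  then show ?thesis
  proof (rule composition_of_cong)
    fix x assume "x \<in> carrier (artin_monoid A)"
    then show "\<phi> x = induced_hom B (\<lambda>i. word_subst (\<lambda>x. [f x]) (w i)) x"
      using idx gen word by (intro artin_hom_eq_induced[OF hom])
        (auto simp: artin_gen_pow)
  qed
qed

lemma elementary_light_composition_of_standard:
  fixes A B :: "'a::infinite coxeter_matrix"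
  assumes "elementary_light A B \<phi>"
  shows "composition_of standard A B \<phi>"
proof (cases "tits_hom A B \<phi>")
  case True
  then show ?thesis by (rule tits_hom_composition_of_standard)
next
  case False
  then consider "tautological A B \<phi>" | "parabolic_projection A B \<phi>" | "natural_inclusion A B \<phi>"
    | "diagram_automorphism A B \<phi>" | "folding A B \<phi>"
    using assms unfolding elementary_light_def by blast
  then have "artin_hom A B \<phi> \<and> (\<forall>i\<in>index A.
      (\<exists>j\<in>index B. \<phi> (artin_gen A i) = artin_gen B j) \<or> \<phi> (artin_gen A i) = \<one>\<^bsub>artin_monoid B\<^esub>)"
  proof cases
    case 1
    then show ?thesis unfolding tautological_def by blast
  next
    case 2
    then show ?thesis unfolding parabolic_projection_def by blast
  next
    case 3
    then show ?thesis unfolding natural_inclusion_def is_submatrix_def by blast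
  next
    case 4
    then show ?thesis unfolding diagram_automorphism_def by (metis bij_betwE)
  next
    case 5
    then show ?thesis unfolding folding_def by blast
  qed
  then have "standard A B \<phi>" using standard_of_generator_map[of A B \<phi>] by blast
  then show ?thesis by (rule composition_of.single) simp
qed

section \<open>Factorisation of light homomorphisms\<close>

lemma standard_artin_hom: "standard A B \<phi> \<Longrightarrow> artin_hom A B \<phi>"
  unfolding standard_def by blast

lemma is_coxeter_restrict:
  "\<lbrakk>is_coxeter_matrix M; J \<subseteq> index M\<rbrakk> \<Longrightarrow> is_coxeter_matrix (M\<lparr>index := J\<rparr>)"
  unfolding is_coxeter_matrix_def by (simp add: subset_eq finite_subset)

lemma coxeter_entry_nonzero:
  assumes "is_coxeter_matrix M" "i \<in> index M" "j \<in> index M"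
  shows "entry M i j \<noteq> 0"
proof (cases "i = j")
  case True
  then have "entry M i j = 1" using assms unfolding is_coxeter_matrix_def by blast
  then show ?thesis by simp
next
  case False
  then have "2 \<le> entry M i j" using assms unfolding is_coxeter_matrix_def by blast
  then show ?thesis by auto
qed

lemma tits_entry_commute: "tits_entry m a b = tits_entry m b a"
  by (simp add: tits_entry_def mult.commute mult.left_commute)

lemma tits_entry_ge_2: "2 \<le> m \<Longrightarrow> 2 \<le> tits_entry m a b"
  by (auto simp: tits_entry_def numeral_eq_enat mult.assoc intro!: Suc_leI gr0I)

lemma light_composition_of_elementary:
  fixes M' M :: "'a::infinite coxeter_matrix"
  assumes "light M' M \<Phi>"
  shows "composition_of elementary_light M' M \<Phi>"
proof -
  have hom: "artin_hom M' M \<Phi>" using assms unfolding light_def by blast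
  then have M': "is_coxeter_matrix M'" and M: "is_coxeter_matrix M" unfolding artin_hom_def by auto
  have "\<forall>i\<in>index M'. \<exists>x. fst x \<in> index M \<and>
      \<Phi> (artin_gen M' i) = artin_gen M (fst x) [^]\<^bsub>artin_monoid M\<^esub> (snd x :: nat)"
    using assms unfolding light_def by fastforce
  then obtain fd where fd: "\<forall>i\<in>index M'. fst (fd i) \<in> index M \<and>
      \<Phi> (artin_gen M' i) = artin_gen M (fst (fd i)) [^]\<^bsub>artin_monoid M\<^esub> (snd (fd i) :: nat)"
    by (rule bchoice[THEN exE])
  define f where "f i = fst (fd i)" for i
  define d where "d i = snd (fd i)" for i
  define g where "g i = replicate (d i) (f i)" for i
  have f: "f i \<in> index M" and gen: "\<Phi> (artin_gen M' i) = artin_word M (g i)" if "i \<in> index M'" for i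
    using fd that artin_gen_pow[of "f i" M "d i"] by (auto simp only: f_def d_def g_def)
  have g: "g i \<in> lists (index M)" if "i \<in> index M'" for i using f[OF that] by (auto simp: g_def)
  have braid: "braid_hom M' M g" by (rule braid_hom_of_artin_hom[OF hom]) (use g gen in auto)
  have rel: "(concat (alt_word n (g i) (g j)), concat (alt_word n (g j) (g i))) \<in> braid_cong M"
    if "i \<in> index M'" "j \<in> index M'" "i \<noteq> j" "entry M' i j = enat n" for i j n
    using braid_hom_cong[OF braid braid_relation_cong[OF that]] by (simp add: map_alt_word)
  have dvd_infinity: "m dvd \<infinity>" if "m \<noteq> 0" for m :: enat
    using that by (intro dvdI[of _ _ \<infinity>]) (simp add: imult_infinity_right zero_less_iff_neq_zero)
  \<comment> \<open>An odd relation would force the images of the two generators to have equal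
    length. With \<open>d i = 0\<close> this gives the parity condition of the projection, with both
    positive it permits the entry 2 in \<open>A1\<close> below.\<close>
  have even: "2 dvd entry M' i j" if "i \<in> index M'" "j \<in> index M'" "d i \<noteq> d j" for i j
  proof (cases "entry M' i j")
    case (enat n)
    have "i \<noteq> j" using that by blast
    then have "even n" using alt_word_swap_length[OF rel[OF that(1,2) _ enat]] that(3) by (auto simp: g_def)
    then obtain k where "n = 2 * k" by (elim evenE)
    then show ?thesis unfolding enat by (intro dvdI[of _ _ "enat k"]) (simp add: numeral_eq_enat)
  qed (simp add: dvd_infinity)
  have tits: "tits_entry (entry M (f i) (f j)) (d i) (d j) dvd entry M' i j"
    if "i \<in> index M'" "j \<in> index M'" "f i \<noteq> f j" "0 < d i" "0 < d j" for i j
  proof (cases "entry M' i j")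
    case (enat n)
    have ij: "i \<noteq> j" using that by blast
    have "0 < n" using coxeter_entry_finite_ge_2[OF M' that(1,2) ij enat] by simp
    then show ?thesis
      unfolding enat
      using tits_entry_dvd_of_block_swap[OF M f[OF that(1)] f[OF that(2)] that(3-5)]
        rel[OF that(1,2) ij enat] by (simp add: g_def)
  next
    case infinity
    have "2 \<le> entry M (f i) (f j)" using M f that(1-3) unfolding is_coxeter_matrix_def by blast
    from tits_entry_ge_2[OF this, of "d i" "d j"]
    show ?thesis unfolding infinity by (intro dvd_infinity) auto
  qed

  define J where "J = {i \<in> index M'. 0 < d i}"
  \<comment> \<open>A representative of the class of indices with the same pair
    \<open>(f i, d i)\<close>. The choice depends on this pair only, whence
    \<open>r_eq\<close>.\<close>
  define r where "r i = (SOME k. k \<in> J \<and> f k = f i \<and> d k = d i)" for i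
  have J: "J \<subseteq> index M'" by (auto simp: J_def)
  have finJ: "finite J" using M' J finite_subset unfolding is_coxeter_matrix_def by blast
  have r: "r i \<in> J \<and> f (r i) = f i \<and> d (r i) = d i" if "i \<in> J" for i
    unfolding r_def by (rule someI[of _ i]) (simp add: that)
  have r_eq: "r i = r j" if "f i = f j" "d i = d j" for i j using that by (simp add: r_def)
  have r_inj: "f i \<noteq> f j \<or> d i \<noteq> d j" if "i \<in> r ` J" "j \<in> r ` J" "i \<noteq> j" for i j
    using that r r_eq by (metis imageE)

  define A0 where "A0 = M'\<lparr>index := J\<rparr>"
  \<comment> \<open>Each entry must divide that of \<open>M'\<close> and suit the later maps:
    indices about to be identified by \<open>r\<close> keep their entry, different powers of one
    generator commute, and all other pairs get the Tits entry.\<close>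
  define A1 where "A1 = \<lparr>index = J, entry = (\<lambda>i j. if i = j then 1
      else if f i = f j then (if d i = d j then entry M' i j else 2)
      else tits_entry (entry M (f i) (f j)) (d i) (d j))\<rparr>"
  define A2 where "A2 = A1\<lparr>index := r ` J\<rparr>"
  define A4 where "A4 = M\<lparr>index := f ` J\<rparr>"
  \<comment> \<open>Representatives with the same \<open>f\<close> commute here, so that
    \<open>f\<close> folds \<open>A3\<close> onto the submatrix \<open>A4\<close> and
    \<open>A2\<close> becomes the Tits matrix of \<open>A3\<close> for \<open>d\<close>.\<close>
  define A3 where "A3 = unfold_matrix A4 f (r ` J)"
  have fJ: "f ` J \<subseteq> index M" using f J by blast
  have A0: "is_coxeter_matrix A0" unfolding A0_def by (rule is_coxeter_restrict[OF M' J])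
  have A1: "is_coxeter_matrix A1"
    unfolding is_coxeter_matrix_def
  proof (intro conjI ballI impI)
    fix i j assume "i \<in> index A1" "j \<in> index A1"
    then have ij: "i \<in> index M'" "j \<in> index M'" using J by (auto simp: A1_def)
    show "entry A1 i j = entry A1 j i"
      using coxeter_entry_commute[OF M' ij] coxeter_entry_commute[OF M f[OF ij(1)] f[OF ij(2)]]
      by (simp add: A1_def tits_entry_commute)
    assume "i \<noteq> j"
    then have "2 \<le> entry M' i j" "f i \<noteq> f j \<Longrightarrow> 2 \<le> entry M (f i) (f j)"
      using M M' ij f unfolding is_coxeter_matrix_def by blast+
    then show "2 \<le> entry A1 i j"
      using \<open>i \<noteq> j\<close> by (simp add: A1_def tits_entry_ge_2)
  qed (simp_all add: A1_def finJ)
  have A2: "is_coxeter_matrix A2"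
    unfolding A2_def using r by (intro is_coxeter_restrict[OF A1]) (auto simp: A1_def)
  have A4: "is_coxeter_matrix A4" unfolding A4_def by (rule is_coxeter_restrict[OF M fJ])
  have idx: "index A0 = J" "index A1 = J" "index A2 = r ` J" "index A3 = r ` J"
    by (simp_all add: A0_def A1_def A2_def A3_def)
  have frJ: "f ` r ` J = f ` J" using r by (auto simp: image_image)
  have A3: "is_coxeter_matrix A3"
    unfolding A3_def using finJ frJ by (intro is_coxeter_unfold_matrix[OF A4]) (auto simp: A4_def)

  define g1 where "g1 i = (if i \<in> J then [i] else [])" for i
  have b1: "braid_hom M' A0 g1"
  proof (rule braid_homI[OF M' A0])
    fix i j n assume *: "i \<in> index M'" "j \<in> index M'" "i \<noteq> j" "entry M' i j = enat n"
    show "(word_subst g1 (alt_word n i j), word_subst g1 (alt_word n j i)) \<in> braid_cong A0"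
    proof (cases "i \<in> J \<and> j \<in> J")
      case True
      have single: "concat (alt_word n [i] [j]) = alt_word n i j" for i j :: 'a
        by (induction n arbitrary: i j) auto
      show ?thesis
        using braid_relation_cong[of i A0 j n] True *
        by (simp add: map_alt_word g1_def single) (simp add: A0_def)
    next
      case False
      \<comment> \<open>If just one of the two generators survives the projection, both sides become
        powers of it, with equal exponents because \<open>n\<close> is even.\<close>
      have "even n" if "i \<in> J \<or> j \<in> J"
      proof -
        have "d i \<noteq> d j" using False that * by (auto simp: J_def)
        then show ?thesis using alt_word_swap_length[OF rel[OF *]] by (auto simp: g_def)
      qed
      then have "word_subst g1 (alt_word n i j) = word_subst g1 (alt_word n j i)"
      proof (cases "i \<in> J \<or> j \<in> J")
        case True
        have swap: "concat (alt_word (2 * k) [] x) = concat (alt_word (2 * k) x [])" for k and x :: "'a list"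
          by (induction k) auto
        from True \<open>i \<in> J \<or> j \<in> J \<Longrightarrow> even n\<close> obtain k where "n = 2 * k" by (blast elim: evenE)
        then show ?thesis using False swap by (auto simp: map_alt_word g1_def)
      next
        case False
        then show ?thesis by (simp add: map_alt_word g1_def)
      qed
      moreover have "word_subst g1 (alt_word n i j) \<in> lists (index A0)"
        using * by (intro word_subst_in_lists[of _ "index M'"]) (auto simp: g1_def A0_def)
      ultimately show ?thesis by (simp add: word_cong.refl)
    qed
  qed (auto simp: g1_def A0_def)
  have "parabolic_projection M' A0 (induced_hom A0 g1)"
    unfolding parabolic_projection_def is_submatrix_def
  proof (intro conjI ballI)
    show "artin_hom M' A0 (induced_hom A0 g1)" by (rule artin_hom_induced[OF b1])
    show "index A0 \<subseteq> index M'" using J by (simp add: A0_def)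
    fix j assume j: "j \<in> index A0"
    show "entry A0 j i = entry M' j i" for i by (simp add: A0_def)
    show "2 dvd entry M' i j" if "i \<in> index M' - index A0" for i
      using that j J by (intro even) (auto simp: A0_def J_def)
    show "induced_hom A0 g1 (artin_gen M' j) = artin_gen A0 j"
      using j J by (subst induced_hom_gen[OF b1]) (auto simp: A0_def g1_def artin_gen_def)
  next
    fix i assume "i \<in> index M' - index A0"
    then show "induced_hom A0 g1 (artin_gen M' i) = \<one>\<^bsub>artin_monoid A0\<^esub>"
      by (simp add: induced_hom_gen[OF b1]) (simp add: one_artin g1_def A0_def)
  qed
  then have e1: "elementary_light M' A0 (induced_hom A0 g1)" unfolding elementary_light_def by blast

  have dvd01: "entry A1 i j dvd entry A0 i j" if ij: "i \<in> J" "j \<in> J" for i j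
  proof -
    have "entry M' i i = 1" using M' J ij unfolding is_coxeter_matrix_def by blast
    then show ?thesis
      using even[of i j] tits[of i j] ij by (auto simp: A1_def A0_def J_def)
  qed
  have b2: "braid_hom A0 A1 (\<lambda>i. [i])"
    using dvd01 by (intro braid_hom_letter[OF A0 A1]) (simp_all add: idx)
  have e2: "elementary_light A0 A1 (induced_hom A1 (\<lambda>i. [i]))"
    unfolding elementary_light_def tautological_def
  proof (intro disjI1 conjI ballI)
    show "artin_hom A0 A1 (induced_hom A1 (\<lambda>i. [i]))" by (rule artin_hom_induced[OF b2])
    show "index A0 = index A1" by (simp add: A0_def A1_def)
    show "induced_hom A1 (\<lambda>i. [i]) (artin_gen A0 i) = artin_gen A1 i" if "i \<in> index A0" for i
      by (rule induced_hom_letter[OF b2 that])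
    \<comment> \<open>The cofactor is chosen from the two entries alone, so it inherits their
      symmetry; it is positive because the entries of \<open>A0\<close> are nonzero.\<close>
    define c where "c i j = (SOME k. entry A0 i j = k * entry A1 i j)" for i j
    have c: "entry A0 i j = c i j * entry A1 i j" if "i \<in> J" "j \<in> J" for i j
    proof -
      have "\<exists>k. entry A0 i j = k * entry A1 i j"
        using dvd01[OF that] by (auto simp: dvd_def mult.commute)
      then show ?thesis unfolding c_def by (rule someI_ex)
    qed
    have c1: "c i i = 1" if "i \<in> J" for i
      using c[OF that that] A0 A1 that unfolding is_coxeter_matrix_def idx by simp
    have c2: "c i j = c j i" if "i \<in> J" "j \<in> J" for i j
      using coxeter_entry_commute[OF A0, of i j] coxeter_entry_commute[OF A1, of i j] that
      by (simp add: c_def idx)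
    have c3: "0 < c i j" if "i \<in> J" "j \<in> J" for i j
    proof -
      have "entry A0 i j \<noteq> 0" using coxeter_entry_nonzero[OF A0] that by (simp add: idx)
      then show ?thesis using c[OF that] by (auto simp: zero_less_iff_neq_zero)
    qed
    show "\<exists>d. (\<forall>i\<in>index A1. d i i = 1) \<and> (\<forall>i\<in>index A1. \<forall>j\<in>index A1.
        d i j = d j i \<and> d i j > 0 \<and> entry A0 i j = d i j * entry A1 i j)"
      unfolding idx by (intro exI[of _ c] conjI ballI c1 c2 c3 c)
  qed

  have A12: "entry A2 (r i) (r j) = entry A1 i j" if "i \<in> J" "j \<in> J" "r i \<noteq> r j" for i j
    using r[OF that(1)] r[OF that(2)] r_eq[of i j] that(3) by (auto simp: A1_def A2_def)
  have b3: "braid_hom A1 A2 (\<lambda>i. [r i])"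
    using A12 by (intro braid_hom_letter[OF A1 A2]) (simp_all add: idx)
  have e3: "elementary_light A1 A2 (induced_hom A2 (\<lambda>i. [r i]))"
    unfolding elementary_light_def folding_def
  proof (intro disjI2 conjI exI[of _ r] ballI impI)
    show "artin_hom A1 A2 (induced_hom A2 (\<lambda>i. [r i]))" by (rule artin_hom_induced[OF b3])
    show "r ` index A1 = index A2" by (simp add: A1_def A2_def)
    show "induced_hom A2 (\<lambda>i. [r i]) (artin_gen A1 i) = artin_gen A2 (r i)" if "i \<in> index A1" for i
      by (rule induced_hom_letter[OF b3 that])
    fix i j assume ij: "i \<in> index A1" "j \<in> index A1"
    then have J2: "i \<in> J" "j \<in> J" by (simp_all add: A1_def)
    show "entry A2 (r i) (r j) = entry A1 i j" if "r i \<noteq> r j" using A12[OF J2 that] .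
    fix k assume "k \<in> index A1" and k: "r j = r k \<and> r k \<noteq> r i"
    then have "k \<in> J" by (simp add: A1_def)
    then show "entry A1 i j = entry A1 i k"
      using A12[OF J2(1), of j] A12[OF J2(1), of k] J2 k by metis
  qed

  \<comment> \<open>Distinct representatives with the same \<open>f\<close> differ in
    \<open>d\<close> and have entry 2 in both matrices; \<open>tits_entry\<close> leaves this 2 and
    the 1 on the diagonal unchanged.\<close>
  have A23: "entry A2 i j = tits_entry (entry A3 i j) (d i) (d j)" if "i \<in> r ` J" "j \<in> r ` J" for i j
  proof -
    have "(1::enat) \<le> 2" by (simp add: one_enat_def numeral_eq_enat)
    then show ?thesis
      using r_inj[OF that] by (auto simp: A1_def A2_def A3_def A4_def tits_entry_def)
  qed
  have b4: "braid_hom A2 A3 (\<lambda>i. replicate (d i) i)"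
    using A23 idx by (intro braid_hom_tits[OF A2 A3]) auto
  have "tits_hom A2 A3 (induced_hom A3 (\<lambda>i. replicate (d i) i))"
    unfolding tits_hom_def
  proof (intro conjI exI[of _ d] ballI)
    show "artin_hom A2 A3 (induced_hom A3 (\<lambda>i. replicate (d i) i))" by (rule artin_hom_induced[OF b4])
    show "index A2 = index A3" by (simp add: idx)
    show "0 < d i" if "i \<in> index A3" for i using that r unfolding idx J_def by auto
    show "entry A2 i j = tits_entry (entry A3 i j) (d i) (d j)"
      if "i \<in> index A3" "j \<in> index A3" for i j using A23 that by (simp add: idx)
    show "induced_hom A3 (\<lambda>i. replicate (d i) i) (artin_gen A2 i) =
        artin_gen A3 i [^]\<^bsub>artin_monoid A3\<^esub> d i" if "i \<in> index A2" for i
      using that by (simp add: induced_hom_gen[OF b4] artin_gen_pow idx)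
  qed
  then have e4: "elementary_light A2 A3 (induced_hom A3 (\<lambda>i. replicate (d i) i))"
    unfolding elementary_light_def by blast

  have b5: "braid_hom A3 A4 (\<lambda>i. [f i])"
    unfolding A3_def using finJ frJ by (intro braid_hom_unfold_fold[OF A4]) (auto simp: A4_def)
  have e5: "elementary_light A3 A4 (induced_hom A4 (\<lambda>i. [f i]))"
    unfolding elementary_light_def folding_def
  proof (intro disjI2 conjI exI[of _ f] ballI impI)
    show "artin_hom A3 A4 (induced_hom A4 (\<lambda>i. [f i]))" by (rule artin_hom_induced[OF b5])
    show "f ` index A3 = index A4" using frJ by (simp add: A3_def A4_def)
    show "induced_hom A4 (\<lambda>i. [f i]) (artin_gen A3 i) = artin_gen A4 (f i)" if "i \<in> index A3" for i
      by (rule induced_hom_letter[OF b5 that])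
    fix i j
    show "entry A4 (f i) (f j) = entry A3 i j" if "f i \<noteq> f j" using that by (auto simp: A3_def)
    fix k assume "f j = f k \<and> f k \<noteq> f i"
    then show "entry A3 i j = entry A3 i k" by (auto simp: A3_def)
  qed

  have b6: "braid_hom A4 M (\<lambda>i. [i])"
    using fJ by (intro braid_hom_letter[OF A4 M]) (auto simp: A4_def)
  have e6: "elementary_light A4 M (induced_hom M (\<lambda>i. [i]))"
  proof -
    have "natural_inclusion A4 M (induced_hom M (\<lambda>i. [i]))"
      unfolding natural_inclusion_def is_submatrix_def
      using artin_hom_induced[OF b6] induced_hom_letter[OF b6] fJ by (simp add: A4_def)
    then show ?thesis unfolding elementary_light_def by blast
  qed

  note comp = braid_hom_comp and step = composition_of_induced_step
  have c1: "composition_of elementary_light M' A0 (induced_hom A0 g1)"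
    by (rule composition_of.single[where K = elementary_light], rule e1) simp
  note c2 = step[OF c1 e2 b1 b2] and p2 = comp[OF b1 b2]
  note c3 = step[OF c2 e3 p2 b3] and p3 = comp[OF p2 b3]
  note c4 = step[OF c3 e4 p3 b4] and p4 = comp[OF p3 b4]
  note c5 = step[OF c4 e5 p4 b5] and p5 = comp[OF p4 b5]
  note c6 = step[OF c5 e6 p5 b6] and p6 = comp[OF p5 b6]
  show ?thesis
  proof (rule composition_of_cong[OF c6], rule artin_hom_eq_induced[OF hom])
    fix i assume i: "i \<in> index M'"
    \<comment> \<open>For \<open>i\<close> in \<open>J\<close> this uses that \<open>r\<close>
      preserves \<open>f\<close> and \<open>d\<close>; otherwise \<open>d i = 0\<close> and both
      sides are empty.\<close>
    have "word_subst (\<lambda>i. [i]) (word_subst (\<lambda>i. [f i]) (word_subst (\<lambda>i. replicate (d i) i)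
        (word_subst (\<lambda>i. [r i]) (word_subst (\<lambda>i. [i]) (g1 i))))) = g i"
      using r[of i] i by (auto simp: g1_def g_def J_def)
    then show "word_subst (\<lambda>i. [i]) (word_subst (\<lambda>i. [f i]) (word_subst (\<lambda>i. replicate (d i) i)
        (word_subst (\<lambda>i. [r i]) (word_subst (\<lambda>i. [i]) (g1 i))))) \<in> lists (index M)"
      and "\<Phi> (artin_gen M' i) = artin_word M (word_subst (\<lambda>i. [i]) (word_subst (\<lambda>i. [f i])
        (word_subst (\<lambda>i. replicate (d i) i) (word_subst (\<lambda>i. [r i]) (word_subst (\<lambda>i. [i]) (g1 i))))))"
      using g[OF i] gen[OF i] by (simp_all only:)
  qed
qed

theorem theorem4p22:
  fixes M' M :: "'a::infinite coxeter_matrix"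
    and \<Phi> :: "'a list set \<Rightarrow> 'a list set"
  assumes "is_coxeter_matrix M'" and "is_coxeter_matrix M"
    and "light M' M \<Phi>"
  shows "composition_of elementary_light M' M \<Phi> \<and> ast_morphism M' M \<Phi>"
proof
  show light: "composition_of elementary_light M' M \<Phi>"
    by (rule light_composition_of_elementary[OF assms(3)])
  show "ast_morphism M' M \<Phi>"
    unfolding ast_morphism_def
    by (rule composition_of_refine[OF light elementary_light_composition_of_standard standard_artin_hom])
qed

end
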